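(* Let $X$ be a real-valued random variable with $\mathsf E|X|<\infty$ and $\mathsf E X=0$, let $U$ be a random variable independent of $X$ and uniformly distributed on $[0,1]$, and let $\mathsf r=\mathsf r_X$ be the reciprocating function of $X$. Let $g\colon\mathbb R^2\to\mathbb R$ be any Borel function bounded from below (or from above). Then $$\mathsf E\, g\big(X,\mathsf r(X,U)\big)=\int_{\mathbb R\times[0,1]}\mathsf E\, g\big(X_{x,\mathsf r(x,u)},R_{x,\mathsf r(x,u)}\big)\,\mathsf P(X\in dx)\,du .$$ Instead of the condition that $g$ be bounded from below or above, it is enough to require only that, for some real constant $c$, the function $(x,r)\mapsto g(x,r)-cx$ be bounded from below (or from above) on $\mathbb R^2$.
   Context: Reciprocating function. For a finite nonnegative Borel measure $\nu$ on $\mathbb R$ (extended to $[-\infty,\infty]$ by $\nu(\{\pm\infty\})=0$) define $G=G_\nu\colon[-\infty,\infty]\to[0,\infty]$ by $G(x)=\int_{(0,x]}z\,\nu(dz)$ for $x\in[0,\infty]$ and $G(x)=\int_{[x,0)}(-z)\,\nu(dz)$ for $x\in[-\infty,0]$. For $h\in[-\infty,\infty]$ let $x_+(h)=\inf\{x\in[0,\infty]\colon G(x)\ge h\}$ and $x_-(h)=\sup\{x\in[-\infty,0]\colon G(x)\ge h\}$ (with $\inf\emptyset=\infty$, $\sup\emptyset=-\infty$). For $u\in[0,1]$ let $\tilde G(x,u)=G(x-)+(G(x)-G(x-))u$ if $x\in[0,\infty]$ and $\tilde G(x,u)=G(x+)+(G(x)-G(x+))u$ if $x\in[-\infty,0]$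 (one-sided limits; note $G$ is continuous at $0$, $G(0)=0$). The reciprocating function of $\nu$ is $\mathsf r_\nu(x,u)=x_-(\tilde G(x,u))$ if $x\in[0,\infty]$ and $\mathsf r_\nu(x,u)=x_+(\tilde G(x,u))$ if $x\in[-\infty,0]$, $u\in[0,1]$. For a random variable $X$, $\mathsf r_X:=\mathsf r_\nu$ with $\nu$ the distribution of $X$. Two-point variables. For real $a,b$ with $ab\le0$, $X_{a,b}$ denotes a zero-mean random variable with values in $\{a,b\}$; so $\mathsf P(X_{a,b}=a)=\frac b{b-a}$, $\mathsf P(X_{a,b}=b)=\frac a{a-b}$ if $a\ne b$, and $X_{a,b}=0$ a.s. whenever $ab=0$. Further, $R_{a,b}:=\mathsf r_{X_{a,b}}(X_{a,b},U')$ with $U'$ uniform on $[0,1]$ and independent of $X_{a,b}$; thus, if $ab<0$, a.s. $R_{a,b}=b$ on $\{X_{a,b}=a\}$ and $R_{a,b}=a$ on $\{X_{a,b}=b\}$, while if $ab=0$ then $R_{a,b}=0=X_{a,b}$ a.s. The values $\mathsf r(x,u)$ are finite for almost all $(x,u)$ with respect to $\mathsf P(X\in dx)\,du$; on the exceptional null set the integrand (and the function $g$) may be given arbitrary values. *)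

theory Defs
  imports "HOL-Probability.Probability"
begin

section \<open>Extended expectations\<close>

text \<open>
  The expectations in question may be infinite, so the Bochner integral (which is 0 for
  non-integrable functions) is not appropriate. Note that \<^const>\<open>e2ennreal\<close> sends negative values
  to 0, so the two terms are the integrals of the positive and of the negative part. The value
  of \<open>ext_integral\<close> is meaningful only together with \<open>quasi_integrable\<close>.
\<close>

definition quasi_integrable :: "'a measure \<Rightarrow> ('a \<Rightarrow> ereal) \<Rightarrow> bool" where
  "quasi_integrable M f \<longleftrightarrow> f \<in> borel_measurable M \<and>
     ((\<integral>\<^sup>+ \<omega>. e2ennreal (f \<omega>) \<partial>M) < \<infinity> \<or> (\<integral>\<^sup>+ \<omega>. e2ennreal (- f \<omega>) \<partial>M) < \<infinity>)"

definition ext_integral :: "'a measure \<Rightarrow> ('a \<Rightarrow> ereal) \<Rightarrow> ereal" where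
  "ext_integral M f =
     enn2ereal (\<integral>\<^sup>+ \<omega>. e2ennreal (f \<omega>) \<partial>M) - enn2ereal (\<integral>\<^sup>+ \<omega>. e2ennreal (- f \<omega>) \<partial>M)"

section \<open>The reciprocating function\<close>

definition G :: "real measure \<Rightarrow> ereal \<Rightarrow> ereal" where
  "G \<nu> x = enn2ereal
     (if 0 \<le> x then \<integral>\<^sup>+ z\<in>{z. 0 < z \<and> ereal z \<le> x}. ennreal z \<partial>\<nu>
      else \<integral>\<^sup>+ z\<in>{z. x \<le> ereal z \<and> z < 0}. ennreal (- z) \<partial>\<nu>)"

definition x_plus :: "real measure \<Rightarrow> ereal \<Rightarrow> ereal" where
  "x_plus \<nu> h = Inf {x. 0 \<le> x \<and> G \<nu> x \<ge> h}"

definition x_minus :: "real measure \<Rightarrow> ereal \<Rightarrow> ereal" where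
  "x_minus \<nu> h = Sup {x. x \<le> 0 \<and> G \<nu> x \<ge> h}"

text \<open>
  At \<open>x = 0\<close> the two cases of the next two definitions agree (all values are 0), so a
  conditional may be used. Only \<open>u\<close> in the unit interval is relevant.
\<close>

definition G_tilde :: "real measure \<Rightarrow> ereal \<Rightarrow> real \<Rightarrow> ereal" where
  "G_tilde \<nu> x u =
     (if 0 \<le> x then Lim (at_left x) (G \<nu>) + (G \<nu> x - Lim (at_left x) (G \<nu>)) * ereal u
      else Lim (at_right x) (G \<nu>) + (G \<nu> x - Lim (at_right x) (G \<nu>)) * ereal u)"

definition recip :: "real measure \<Rightarrow> ereal \<Rightarrow> real \<Rightarrow> ereal" where
  "recip \<nu> x u = (if 0 \<le> x then x_minus \<nu> (G_tilde \<nu> x u) else x_plus \<nu> (G_tilde \<nu> x u))"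

text \<open>
  The values of \<open>recip\<close> are finite almost everywhere when the mean is zero; on the exceptional null set
  \<^const>\<open>real_of_ereal\<close> picks the value 0.
\<close>

definition recip_real :: "real measure \<Rightarrow> real \<Rightarrow> real \<Rightarrow> real" where
  "recip_real \<nu> x u = real_of_ereal (recip \<nu> (ereal x) u)"

section \<open>Two-point zero-mean variables\<close>

abbreviation uniform01 :: "real measure" where
  "uniform01 \<equiv> uniform_measure lborel {0..1}"

text \<open>
  The law of \<open>X\<^bsub>a,b\<^esub>\<close>, for \<open>a * b \<le> 0\<close>: it is \<open>a\<close> with probability \<open>b / (b - a)\<close> and \<open>b\<close>
  otherwise. If \<open>a = b\<close> (so both are 0), division by zero yields the point mass at \<open>b = 0\<close>.
\<close>

definition two_point :: "real \<Rightarrow> real \<Rightarrow> real measure" where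
  "two_point a b =
     distr (measure_pmf (bernoulli_pmf (b / (b - a)))) borel (\<lambda>t. if t then a else b)"

text \<open>
  \<open>X\<^bsub>a,b\<^esub>\<close> and the independent uniform variable are realised as the coordinates of a
  product space, the reciprocating function being that of \<open>X\<^bsub>a,b\<^esub>\<close>; so the integrand below is
  \<open>g (X\<^bsub>a,b\<^esub>, R\<^bsub>a,b\<^esub>)\<close>.
\<close>

definition two_point_space :: "real \<Rightarrow> real \<Rightarrow> (real \<times> real) measure" where
  "two_point_space a b = two_point a b \<Otimes>\<^sub>M uniform01"

definition two_point_fun :: "(real \<times> real \<Rightarrow> real) \<Rightarrow> real \<Rightarrow> real \<Rightarrow> real \<times> real \<Rightarrow> ereal" where
  "two_point_fun g a b = (\<lambda>(y, v). ereal (g (y, recip_real (two_point a b) y v)))"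

end

theory Submission
  imports Defs
begin

text \<open>
  Let \<open>m\<close> be the common value of \<open>E max(X,0)\<close> and \<open>E max(-X,0)\<close>, and let \<open>\<mu>\<close> be the measure
  \<open>z \<nu>(dz)\<close> on the positive half-line. The randomised distribution function of \<open>\<mu>\<close> maps
  \<open>\<mu>(dx) du\<close> to Lebesgue measure \<open>dh\<close> on \<open>(0,m)\<close>, and \<open>x = x\<^sub>+(h)\<close>, \<open>r(x,u) = x\<^sub>-(h)\<close> almost
  everywhere. Reflecting for the negative half-line, one gets, for nonnegative \<open>f\<close> and with
  \<open>b = x\<^sub>+(h)\<close>, \<open>a = x\<^sub>-(h)\<close>,
  \<open>E f(X,r(X,U)) = f(0,0) P(X=0) + \<integral>\<^sub>0\<^sup>m (f(b,a)/b + f(a,b)/(-a)) dh\<close>.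
  Replacing \<open>f\<close> by its two-point mean \<open>(b f(a,b) - a f(b,a))/(b - a)\<close>, symmetric in \<open>a\<close> and \<open>b\<close>,
  leaves the integrand unchanged because \<open>1/b + 1/(-a) = (b - a)/(b (-a))\<close>. The signed case follows
  since the two-point mean sends \<open>c x + d\<close> to \<open>d\<close>.
\<close>

section \<open>The randomised distribution function\<close>

text \<open>The distributional transform of \<open>M\<close>. For \<open>M = size_bias \<nu>\<close>
  and \<open>0 \<le> x\<close> it is the real-valued form of \<open>G_tilde\<close>, see
  \<open>G_tilde_nonneg\<close>.\<close>

definition interp_cdf :: "real measure \<Rightarrow> real \<Rightarrow> real \<Rightarrow> real" where
  "interp_cdf M x u = measure M {..<x} + (cdf M x - measure M {..<x}) * u"

lemma prob_space_uniform01: "prob_space uniform01"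
  by (rule prob_space_uniform_measure) auto

text \<open>Keeps the simplifier from turning \<open>emeasure uniform01\<close> into a quotient of
  Lebesgue measures.\<close>

declare emeasure_uniform_measure [simp del]

lemma emeasure_uniform01:
  "A \<in> sets borel \<Longrightarrow> emeasure uniform01 A = emeasure lborel ({0..1} \<inter> A)"
  by (simp add: emeasure_uniform_measure divide_ennreal_def)

text \<open>The endpoint \<open>u = 0\<close> is left out because there the level at the positive
  atom of a two-point law is 0, and the reciprocal is 0 instead of the other atom.\<close>

lemma AE_uniform01: "AE u in uniform01. 0 < u \<and> u \<le> (1::real)"
proof (rule AE_uniform_measureI)
  show "AE x in lborel. x \<in> {0..1} \<longrightarrow> 0 < x \<and> x \<le> (1::real)"
    using AE_lborel_singleton[of "0::real"] by eventually_elim auto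
qed auto

lemma AE_pair_snd:
  assumes "sigma_finite_measure M" "sigma_finite_measure N" "AE y in N. P y"
  shows "AE z in M \<Otimes>\<^sub>M N. P (snd z)"
proof -
  interpret M: sigma_finite_measure M by fact
  interpret N: sigma_finite_measure N by fact
  interpret pair_sigma_finite M N ..
  from assms(3) obtain A where A: "{y \<in> space N. \<not> P y} \<subseteq> A" "A \<in> null_sets N"
    by (auto elim!: AE_E simp: null_sets_def)
  have "space M \<times> A \<in> null_sets (M \<Otimes>\<^sub>M N)"
    using A by (auto simp: null_sets_def N.emeasure_pair_measure_Times)
  then show ?thesis
    by (rule AE_I') (use A in \<open>auto simp: space_pair_measure\<close>)
qed

context finite_borel_measure
begin

lemma measure_lessThan_le_cdf: "measure M {..<x} \<le> cdf M x"
  unfolding cdf_def by (intro finite_measure_mono) auto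

lemma cdf_le_measure_lessThan: "x < y \<Longrightarrow> cdf M x \<le> measure M {..<y}"
  unfolding cdf_def by (intro finite_measure_mono) auto

lemma measure_singleton_eq_jump: "measure M {x} = cdf M x - measure M {..<x}"
proof -
  have "measure M {..x} = measure M {..<x} + measure M {x}"
    unfolding ivl_disj_un(2)[symmetric] by (subst finite_measure_Union) auto
  then show ?thesis by (simp add: cdf_def)
qed

lemma interp_cdf_lower: "0 \<le> u \<Longrightarrow> measure M {..<x} \<le> interp_cdf M x u"
  using measure_lessThan_le_cdf[of x] by (simp add: interp_cdf_def)

lemma interp_cdf_upper: "u \<le> 1 \<Longrightarrow> interp_cdf M x u \<le> cdf M x"
  using mult_left_mono[of u 1 "cdf M x - measure M {..<x}"] measure_lessThan_le_cdf[of x]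
  by (simp add: interp_cdf_def)

lemma borel_measurable_cdf [measurable]: "cdf M \<in> borel_measurable borel"
  by (intro borel_measurable_mono monoI cdf_nondecreasing)

lemma borel_measurable_measure_lessThan [measurable]:
  "(\<lambda>x. measure M {..<x}) \<in> borel_measurable borel"
  by (intro borel_measurable_mono monoI finite_measure_mono) auto

lemma borel_measurable_interp_cdf [measurable (raw)]:
  assumes [measurable]: "f \<in> borel_measurable N" "h \<in> borel_measurable N"
  shows "(\<lambda>x. interp_cdf M (f x) (h x)) \<in> borel_measurable N"
  unfolding interp_cdf_def by measurable

text \<open>The point \<open>b\<close> is the upper quantile \<open>Inf {x. h < cdf M x}\<close>.
  The first alternative covers \<open>h = 0\<close> for a measure charging every left half-line,
  where that infimum would be minus infinity.\<close>

lemma cdf_quantile: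
  assumes "0 \<le> h" "h < measure M UNIV"
  shows "(h = 0 \<and> (\<forall>x. h < cdf M x)) \<or>
         (\<exists>b. measure M {..<b} \<le> h \<and> h \<le> cdf M b \<and> (\<forall>x>b. h < measure M {..<x}))"
proof (cases "\<forall>x. h < cdf M x")
  case True
  have "h \<le> 0"
    using cdf_lim_at_bot by (rule tendsto_lowerbound) (use True in \<open>auto simp: less_imp_le\<close>)
  with True assms show ?thesis by simp
next
  case False
  then obtain y where y: "cdf M y \<le> h" by (auto simp: not_less)
  define S where "S = {x. h < cdf M x}"
  have "eventually (\<lambda>x. h < cdf M x) at_top"
    using cdf_lim_at_top assms by (intro order_tendstoD(1)) (auto simp: borel_UNIV)
  then have ne: "S \<noteq> {}" unfolding S_def by (auto dest: eventually_happens)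
  have "y \<le> x" if "x \<in> S" for x
    using that y cdf_nondecreasing[of x y] by (force simp: S_def not_le[symmetric])
  then have bdd: "bdd_below S" by (auto simp: bdd_below_def)
  define b where "b = Inf S"
  have lt: "cdf M x \<le> h" if "x < b" for x
  proof (rule ccontr)
    assume "\<not> cdf M x \<le> h"
    then have "x \<in> S" by (simp add: S_def)
    from cInf_lower[OF this bdd] that show False by (simp add: b_def)
  qed
  have gt: "\<exists>y\<in>S. y < x" if "b < x" for x
    using that cInf_less_iff[OF ne bdd, of x] unfolding b_def by blast
  have "measure M {..<b} \<le> h"
    by (rule tendsto_upperbound[OF cdf_at_left])
       (auto simp: eventually_at_left_field intro!: exI[of _ "b - 1"] lt)
  moreover have "h \<le> cdf M b"
  proof (rule tendsto_lowerbound)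
    show "(cdf M \<longlongrightarrow> cdf M b) (at_right b)"
      using cdf_is_right_cont by (simp add: continuous_within)
    show "eventually (\<lambda>x. h \<le> cdf M x) (at_right b)"
      unfolding eventually_at_right_field
    proof (intro exI[of _ "b + 1"] conjI allI impI)
      fix x assume "b < x"
      with gt obtain y where "h < cdf M y" "y < x" by (auto simp: S_def)
      then show "h \<le> cdf M x" using cdf_nondecreasing[of y x] by simp
    qed simp
  qed simp
  moreover have "h < measure M {..<x}" if x: "b < x" for x
  proof -
    from gt[OF x] obtain y where "h < cdf M y" "y < x" by (auto simp: S_def)
    then show ?thesis using cdf_le_measure_lessThan[of y x] by simp
  qed
  ultimately show ?thesis by blast
qed

text \<open>Split at the quantile \<open>b\<close> of \<open>h\<close>: points to its right count
  fully, points to its left not at all, and an atom at \<open>b\<close> counts by the share of its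
  jump above \<open>h\<close>. The total is the tail of Lebesgue measure on the interval from 0 to
  the total mass.\<close>

lemma emeasure_interp_cdf_greater:
  assumes h: "0 \<le> h" "h < measure M UNIV"
  shows "(\<integral>\<^sup>+x. emeasure uniform01 {u. h < interp_cdf M x u} \<partial>M) = ennreal (measure M UNIV - h)"
proof -
  interpret U: prob_space uniform01 by (rule prob_space_uniform01)
  note M_is_borel[measurable_cong]
  have full: "emeasure uniform01 {u. h < interp_cdf M x u} = 1" if "h < measure M {..<x}" for x
  proof (rule U.emeasure_eq_1_AE)
    show "AE u in uniform01. u \<in> {u. h < interp_cdf M x u}"
      using AE_uniform01 by eventually_elim (auto intro: less_le_trans[OF that interp_cdf_lower])
  qed simp
  from cdf_quantile[OF h] show ?thesis
  proof (elim disjE exE conjE)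
    assume "h = 0" and pos: "\<forall>x. h < cdf M x"
    have "emeasure uniform01 {u. h < interp_cdf M x u} = 1" for x
      by (rule full) (use pos[rule_format, of "x - 1"] cdf_le_measure_lessThan[of "x - 1" x] in simp)
    then show ?thesis
      using \<open>h = 0\<close> by (simp add: emeasure_eq_measure borel_UNIV)
  next
    fix b assume b: "measure M {..<b} \<le> h" "h \<le> cdf M b" "\<forall>x>b. h < measure M {..<x}"
    define c where "c = emeasure uniform01 {u. h < interp_cdf M b u}"
    have none: "emeasure uniform01 {u. h < interp_cdf M x u} = 0" if "x < b" for x
    proof -
      have "AE u in uniform01. \<not> h < interp_cdf M x u"
        using AE_uniform01
      proof eventually_elim
        case (elim u)
        then show ?case
          using interp_cdf_upper[of u x] cdf_le_measure_lessThan[OF that] b(1) by simp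
      qed
      then show ?thesis by (subst (asm) AE_iff_measurable[OF _ refl]) auto
    qed
    \<comment> \<open>Without an atom at \<open>b\<close> both sides are 0, because \<open>h\<close>
      is squeezed between two equal values.\<close>
    have c: "c * emeasure M {b} = ennreal (cdf M b - h)"
    proof (cases "cdf M b = measure M {..<b}")
      case True
      then show ?thesis
        using b by (simp add: emeasure_eq_measure measure_singleton_eq_jump)
    next
      case False
      define D where "D = cdf M b - measure M {..<b}"
      have D: "D > 0" using False measure_lessThan_le_cdf[of b] by (simp add: D_def)
      \<comment> \<open>The relative height of \<open>h\<close> inside the jump at \<open>b\<close>;
        the transform exceeds \<open>h\<close> exactly for \<open>u > q\<close>.\<close>
      define q where "q = (h - measure M {..<b}) / D"
      have q: "0 \<le> q" "q \<le> 1" using b D by (auto simp: q_def D_def divide_simps)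
      have "h < interp_cdf M b u \<longleftrightarrow> q < u" for u
        using D unfolding interp_cdf_def q_def D_def[symmetric] pos_divide_less_eq[OF D]
        by (simp add: less_diff_eq algebra_simps)
      then have "{u. h < interp_cdf M b u} = {q<..}"
        by (simp add: greaterThan_def)
      moreover have "{0..1} \<inter> {q<..} = {q<..1}"
        using q(1) by force
      ultimately have "c = ennreal (1 - q)"
        using q by (simp add: c_def emeasure_uniform01)
      then have "c * emeasure M {b} = ennreal ((1 - q) * D)"
        using q D by (simp add: emeasure_eq_measure measure_singleton_eq_jump D_def ennreal_mult)
      also have "(1 - q) * D = cdf M b - h"
      proof -
        have "q * D = h - measure M {..<b}" using D by (simp add: q_def)
        then show ?thesis by (simp add: left_diff_distrib D_def)
      qed
      finally show ?thesis .
    qed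
    have "emeasure uniform01 {u. h < interp_cdf M x u} = indicator {b<..} x + c * indicator {b} x"
      for x
      using none[of x] full[of x] b(3) by (cases x b rule: linorder_cases) (auto simp: c_def)
    then have "(\<integral>\<^sup>+x. emeasure uniform01 {u. h < interp_cdf M x u} \<partial>M) =
        emeasure M {b<..} + c * emeasure M {b}"
      by (simp add: nn_integral_add nn_integral_cmult)
    also have "emeasure M {b<..} = ennreal (measure M UNIV - cdf M b)"
    proof -
      have "{b<..} = UNIV - {..b}" by auto
      then have "measure M {b<..} = measure M UNIV - cdf M b"
        using finite_measure_Diff[of UNIV "{..b}"] by (simp add: cdf_def)
      then show ?thesis by (simp add: emeasure_eq_measure)
    qed
    finally show ?thesis
      using b cdf_bounded[of b] by (simp add: c borel_UNIV flip: ennreal_plus)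
  qed
qed

text \<open>Randomising over each jump makes the transform uniform even when \<open>M\<close> has
  atoms. Being finite, the two measures need only be compared on the half-lines
  \<open>{h<..}\<close>.\<close>

lemma distr_interp_cdf:
  "distr (M \<Otimes>\<^sub>M uniform01) borel (\<lambda>(x, u). interp_cdf M x u) =
   density lborel (indicator {0<..<measure M UNIV})" (is "?L = ?R")
proof (rule measure_eqI_lessThan)
  interpret U: prob_space uniform01 by (rule prob_space_uniform01)
  interpret pair_sigma_finite M uniform01 ..
  interpret P: finite_measure "M \<Otimes>\<^sub>M uniform01"
    by (rule finite_measure_pair_measure) unfold_locales
  note M_is_borel[measurable_cong]
  let ?m = "measure M UNIV"
  have meas: "(\<lambda>(x, u). interp_cdf M x u) \<in> borel_measurable (M \<Otimes>\<^sub>M uniform01)"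
    by measurable
  interpret L: finite_measure ?L
    using meas by (rule P.finite_measure_distr)
  show "emeasure ?L {h<..} < \<infinity>" for h
    by (simp add: L.emeasure_eq_measure)
  have "emeasure ?L {h<..} = (\<integral>\<^sup>+x. emeasure uniform01 {u. h < interp_cdf M x u} \<partial>M)" for h
  proof -
    have "emeasure ?L {h<..} = emeasure (M \<Otimes>\<^sub>M uniform01) {z. h < interp_cdf M (fst z) (snd z)}"
      using meas by (simp add: emeasure_distr vimage_def space_pair_measure borel_UNIV
          case_prod_beta Collect_conj_eq)
    also have "\<dots> = (\<integral>\<^sup>+x. emeasure uniform01 {u. h < interp_cdf M x u} \<partial>M)"
    proof (subst U.emeasure_pair_measure_alt)
      have "{z \<in> space (M \<Otimes>\<^sub>M uniform01). h < interp_cdf M (fst z) (snd z)} \<in> sets (M \<Otimes>\<^sub>M uniform01)"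
        by measurable
      then show "{z. h < interp_cdf M (fst z) (snd z)} \<in> sets (M \<Otimes>\<^sub>M uniform01)"
        by (simp add: space_pair_measure borel_UNIV)
    qed (simp add: vimage_def)
    finally show ?thesis .
  qed
  moreover have "(\<integral>\<^sup>+x. emeasure uniform01 {u. h < interp_cdf M x u} \<partial>M) = emeasure ?R {h<..}" for h
  proof -
    have R: "emeasure ?R {h<..} = emeasure lborel ({0<..<?m} \<inter> {h<..})"
      by (simp add: emeasure_density flip: indicator_inter_arith)
    have zero: "0 \<le> interp_cdf M x u" if "0 \<le> u" for x u
      using interp_cdf_lower[OF that, of x] measure_nonneg[of M "{..<x}"] by linarith
    \<comment> \<open>For \<open>u\<close> in the unit interval the transform lies between 0 and the
      total mass, so only the middle range needs the quantile.\<close>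
    consider "h < 0" | "0 \<le> h" "h < ?m" | "0 \<le> h" "?m \<le> h" by linarith
    then show ?thesis
    proof cases
      case 1
      have "emeasure uniform01 {u. h < interp_cdf M x u} = 1" for x
      proof (rule U.emeasure_eq_1_AE)
        show "AE u in uniform01. u \<in> {u. h < interp_cdf M x u}"
          using AE_uniform01 by eventually_elim (auto intro: less_le_trans[OF 1 zero])
      qed simp
      moreover have "{0<..<?m} \<inter> {h<..} = {0<..<?m}" using 1 by auto
      ultimately show ?thesis
        by (simp add: R emeasure_eq_measure borel_UNIV)
    next
      case 2
      then have "{0<..<?m} \<inter> {h<..} = {h<..<?m}" by auto
      then show ?thesis using 2 by (simp add: R emeasure_interp_cdf_greater)
    next
      case 3
      have "emeasure uniform01 {u. h < interp_cdf M x u} = 0" for x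
      proof -
        have "AE u in uniform01. \<not> h < interp_cdf M x u"
          using AE_uniform01
        proof eventually_elim
          case (elim u)
          then show ?case
            using interp_cdf_upper[of u x] cdf_bounded[of x] 3 by (simp add: borel_UNIV)
        qed
        then show ?thesis by (subst (asm) AE_iff_measurable[OF _ refl]) auto
      qed
      moreover have "{0<..<?m} \<inter> {h<..} = {}" using 3 by auto
      ultimately show ?thesis by (simp add: R)
    qed
  qed
  ultimately show "emeasure ?L {h<..} = emeasure ?R {h<..}" for h by simp
qed auto

text \<open>
  For the last conjunct: if \<open>y < q < x\<close> with \<open>q\<close> rational, the interpolation at \<open>x\<close> is at least
  \<open>cdf M q\<close>, and its law has no atom there.
\<close>

lemma AE_interp_cdf:
  "AE (x, u) in M \<Otimes>\<^sub>M uniform01. 0 < interp_cdf M x u \<and> interp_cdf M x u < measure M UNIV \<and>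
     interp_cdf M x u \<le> cdf M x \<and> (\<forall>y<x. cdf M y < interp_cdf M x u)"
proof -
  interpret U: prob_space uniform01 by (rule prob_space_uniform01)
  note M_is_borel[measurable_cong]
  let ?P = "\<lambda>h. 0 < h \<and> h < measure M UNIV \<and> (\<forall>q::rat. h \<noteq> cdf M (of_rat q))"
  have "AE h in density lborel (indicator {0<..<measure M UNIV}). ?P h"
  proof (subst AE_density)
    have "AE h in lborel. \<forall>q::rat. h \<noteq> cdf M (of_rat q)"
      unfolding AE_all_countable by (intro allI AE_lborel_singleton)
    then show "AE h in lborel. 0 < (indicator {0<..<measure M UNIV} h :: ennreal) \<longrightarrow> ?P h"
      by eventually_elim (auto simp: indicator_def)
  qed simp
  then have "AE z in M \<Otimes>\<^sub>M uniform01. ?P (interp_cdf M (fst z) (snd z))"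
    unfolding distr_interp_cdf[symmetric] by (subst (asm) AE_distr_iff) (auto simp: case_prod_beta)
  moreover have "AE z in M \<Otimes>\<^sub>M uniform01. 0 < snd z \<and> snd z \<le> 1"
    by (rule AE_pair_snd[OF _ _ AE_uniform01]) unfold_locales
  ultimately show ?thesis
  proof eventually_elim
    case (elim z)
    obtain x u where z: "z = (x, u)" by (cases z)
    have "cdf M y < interp_cdf M x u" if "y < x" for y
    proof -
      from of_rat_dense[OF that] obtain q where q: "y < of_rat q" "of_rat q < x" by auto
      have "cdf M y \<le> cdf M (of_rat q)"
        using q by (intro cdf_nondecreasing) simp
      moreover have "cdf M (of_rat q) \<le> interp_cdf M x u"
        using cdf_le_measure_lessThan[OF q(2)] interp_cdf_lower[of u x] elim z by simp
      moreover have "interp_cdf M x u \<noteq> cdf M (of_rat q)"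
        using elim z by simp
      ultimately show ?thesis by linarith
    qed
    then show ?case using elim z interp_cdf_upper[of u x] by auto
  qed
qed

end

section \<open>The reciprocating function of an integrable law\<close>

text \<open>Since \<open>ennreal\<close> truncates at 0, this is the measure
  \<open>z \<nu>(dz)\<close> on the positive half-line; its distribution function is
  \<open>G\<close> there.\<close>

definition size_bias :: "real measure \<Rightarrow> real measure" where
  "size_bias \<nu> = density \<nu> ennreal"

text \<open>The law of \<open>- X\<close>. It exchanges the two half-lines, so that the work is done
  on the positive one only.\<close>

definition reflection :: "real measure \<Rightarrow> real measure" where
  "reflection \<nu> = distr \<nu> borel uminus"

text \<open>This class is closed under reflection and contains the two-point laws. Mean zero is
  assumed separately, where the two half-lines have to be matched.\<close>

locale integrable_law = real_distribution \<nu> for \<nu> +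
  assumes integrable_id: "integrable \<nu> (\<lambda>x. x)"
begin

lemma finite_borel_measure_size_bias: "finite_borel_measure (size_bias \<nu>)"
  unfolding finite_borel_measure_def finite_borel_measure_axioms_def
proof (intro conjI finite_measureI)
  have "(\<integral>\<^sup>+x. ennreal x \<partial>\<nu>) \<le> (\<integral>\<^sup>+x. ennreal (norm x) \<partial>\<nu>)"
    by (intro nn_integral_mono ennreal_leI) auto
  also have "\<dots> < \<infinity>" using integrable_id by (simp add: integrable_iff_bounded)
  finally show "emeasure (size_bias \<nu>) (space (size_bias \<nu>)) \<noteq> \<infinity>"
    by (simp add: size_bias_def emeasure_density)
qed (simp add: size_bias_def)

sublocale B: finite_borel_measure "size_bias \<nu>"
  by (rule finite_borel_measure_size_bias)

lemma sets_size_bias [simp, measurable_cong]: "sets (size_bias \<nu>) = sets borel"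
  by (rule B.M_is_borel)

lemma measure_size_bias_nonpos: "A \<in> sets borel \<Longrightarrow> A \<subseteq> {..0} \<Longrightarrow> measure (size_bias \<nu>) A = 0"
proof -
  assume A: "A \<in> sets borel" "A \<subseteq> {..0}"
  then have "emeasure (size_bias \<nu>) A = (\<integral>\<^sup>+x. ennreal x * indicator A x \<partial>\<nu>)"
    by (simp add: size_bias_def emeasure_density)
  also have "\<dots> = (\<integral>\<^sup>+x. 0 \<partial>\<nu>)"
    using A by (intro nn_integral_cong) (auto simp: ennreal_neg split: split_indicator)
  finally show ?thesis by (simp add: measure_def)
qed

lemma measure_size_bias_lessThan_0 [simp]: "measure (size_bias \<nu>) {..<0} = 0"
  by (rule measure_size_bias_nonpos) auto

lemma cdf_size_bias_nonpos [simp]: "x \<le> 0 \<Longrightarrow> cdf (size_bias \<nu>) x = 0"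
  unfolding cdf_def by (rule measure_size_bias_nonpos) auto

text \<open>The density vanishes off the positive half-line, so the regions in \<open>G\<close> may
  be replaced by half-lines or the whole line.\<close>

lemma emeasure_size_bias:
  assumes "A \<in> sets borel" "\<And>z. 0 < z \<Longrightarrow> z \<in> B \<longleftrightarrow> z \<in> A"
  shows "(\<integral>\<^sup>+z\<in>B. ennreal z \<partial>\<nu>) = emeasure (size_bias \<nu>) A"
proof -
  have "ennreal z * indicator B z = ennreal z * indicator A z" for z
    using assms(2)[of z] by (cases "0 < z") (simp_all add: indicator_def ennreal_neg)
  then show ?thesis
    using assms(1) by (simp add: size_bias_def emeasure_density)
qed

lemma G_ereal: "0 \<le> x \<Longrightarrow> G \<nu> (ereal x) = ereal (cdf (size_bias \<nu>) x)"
proof -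
  assume x: "0 \<le> x"
  have "(\<integral>\<^sup>+z\<in>{z. 0 < z \<and> ereal z \<le> ereal x}. ennreal z \<partial>\<nu>) = ennreal (cdf (size_bias \<nu>) x)"
    unfolding cdf_def B.emeasure_eq_measure[symmetric] by (rule emeasure_size_bias) auto
  with x show ?thesis
    unfolding G_def by (simp only: ereal_less_eq if_True enn2ereal_ennreal B.cdf_nonneg)
qed

lemma G_PInf: "G \<nu> \<infinity> = ereal (measure (size_bias \<nu>) UNIV)"
proof -
  have "(\<integral>\<^sup>+z\<in>{z. 0 < z \<and> ereal z \<le> \<infinity>}. ennreal z \<partial>\<nu>) = ennreal (measure (size_bias \<nu>) UNIV)"
    unfolding B.emeasure_eq_measure[symmetric] by (rule emeasure_size_bias) auto
  then show ?thesis
    unfolding G_def by (simp only: zero_le ereal_less_eq if_True enn2ereal_ennreal measure_nonneg)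
qed

section \<open>Symmetry under reflection\<close>

lemma integrable_law_reflection: "integrable_law (reflection \<nu>)"
proof -
  have uminus: "uminus \<in> measurable \<nu> (borel :: real measure)"
    by (intro measurable_finite_borel borel_measurable_continuous_onI continuous_intros)
  then have "real_distribution (distr \<nu> borel uminus)"
    by (rule real_distribution_distr)
  moreover have "integrable (distr \<nu> borel uminus) (\<lambda>x. x)"
    using integrable_minus[OF integrable_id]
    by (simp only: integrable_distr_eq[OF uminus measurable_ident_sets[OF refl]])
  ultimately show ?thesis
    unfolding reflection_def integrable_law_def integrable_law_axioms_def by blast
qed

lemma reflection_reflection: "reflection (reflection \<nu>) = \<nu>"
  unfolding reflection_def by (subst distr_distr) (auto simp: o_def intro!: distr_id2)

lemma G_reflection: "G (reflection \<nu>) (- x) = G \<nu> x"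
proof (cases x "0::ereal" rule: linorder_cases)
  case less
  then have "0 \<le> - x" "\<not> 0 \<le> x" by (auto simp: ereal_0_le_uminus_iff)
  moreover have "ereal (-z) \<le> - x \<longleftrightarrow> x \<le> ereal z" for z
    by (metis ereal_minus_le_minus uminus_ereal.simps(1))
  ultimately show ?thesis
    unfolding G_def reflection_def
    by (simp, subst nn_integral_distr) (auto intro!: arg_cong[where f=enn2ereal] nn_integral_cong simp: indicator_def)
next
  case equal
  have *: "{z::real. 0 < z \<and> ereal z \<le> 0} = {}" by auto
  show ?thesis using equal by (simp add: G_def *)
next
  case greater
  then have "0 \<le> x" "\<not> 0 \<le> - x" by (auto simp: ereal_0_le_uminus_iff)
  moreover have "- x \<le> ereal (-z) \<longleftrightarrow> ereal z \<le> x" for z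
    by (metis ereal_minus_le_minus uminus_ereal.simps(1))
  ultimately show ?thesis
    unfolding G_def reflection_def
    by (simp, subst nn_integral_distr) (auto intro!: arg_cong[where f=enn2ereal] nn_integral_cong simp: indicator_def)
qed

lemma x_plus_reflection: "x_plus (reflection \<nu>) h = - x_minus \<nu> h"
proof -
  have "{x. 0 \<le> x \<and> h \<le> G (reflection \<nu>) x} = uminus ` {x. x \<le> 0 \<and> h \<le> G \<nu> x}"
  proof (intro equalityI subsetI)
    fix x assume "x \<in> {x. 0 \<le> x \<and> h \<le> G (reflection \<nu>) x}"
    then show "x \<in> uminus ` {x. x \<le> 0 \<and> h \<le> G \<nu> x}"
      using G_reflection[of "- x"] by (intro image_eqI[of _ _ "- x"]) auto
  qed (auto simp: G_reflection)
  then show ?thesis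
    by (simp add: x_plus_def x_minus_def ereal_Inf_uminus_image_eq)
qed

lemma x_minus_reflection: "x_minus (reflection \<nu>) h = - x_plus \<nu> h"
  using integrable_law.x_plus_reflection[OF integrable_law_reflection, of h]
  by (simp add: reflection_reflection)

section \<open>One-sided limits of \<open>G\<close> and the randomised level\<close>

lemma tendsto_G_at_left:
  assumes "0 < x"
  shows "(G \<nu> \<longlongrightarrow> ereal (measure (size_bias \<nu>) {..<x})) (at_left (ereal x))"
  unfolding at_left_ereal filterlim_filtermap
proof (rule Lim_transform_eventually)
  show "((\<lambda>y. ereal (cdf (size_bias \<nu>) y)) \<longlongrightarrow> ereal (measure (size_bias \<nu>) {..<x})) (at_left x)"
    by (intro tendsto_intros B.cdf_at_left)
  show "\<forall>\<^sub>F y in at_left x. ereal (cdf (size_bias \<nu>) y) = G \<nu> (ereal y)"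
    unfolding eventually_at_left_field using assms by (intro exI[of _ 0]) (auto simp: G_ereal)
qed

text \<open>Serves the reflected law: there it yields the left limit of \<open>G\<close> at 0, which
  belongs to the other branch of \<open>G\<close>.\<close>

lemma tendsto_G_at_right_0: "(G \<nu> \<longlongrightarrow> 0) (at_right (ereal 0))"
  unfolding at_right_ereal filterlim_filtermap
proof (rule Lim_transform_eventually)
  have "((\<lambda>y. ereal (cdf (size_bias \<nu>) y)) \<longlongrightarrow> ereal (cdf (size_bias \<nu>) 0)) (at_right 0)"
    using B.cdf_is_right_cont[of 0] by (intro tendsto_intros) (simp only: continuous_within)
  then show "((\<lambda>y. ereal (cdf (size_bias \<nu>) y)) \<longlongrightarrow> 0) (at_right 0)"
    by (simp only: cdf_size_bias_nonpos zero_ereal_def order_refl)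
  show "\<forall>\<^sub>F y in at_right 0. ereal (cdf (size_bias \<nu>) y) = G \<nu> (ereal y)"
    unfolding eventually_at_right_field by (intro exI[of _ 1]) (auto simp: G_ereal)
qed

lemma tendsto_G_at_right_iff:
  "(G (reflection \<nu>) \<longlongrightarrow> l) (at_right (ereal (- x))) \<longleftrightarrow> (G \<nu> \<longlongrightarrow> l) (at_left (ereal x))"
proof -
  have "(\<lambda>y. G (reflection \<nu>) (ereal (- y))) = (\<lambda>y. G \<nu> (ereal y))"
    using G_reflection[of "ereal y" for y] by auto
  then show ?thesis
    by (simp add: at_right_ereal at_left_ereal filterlim_filtermap at_right_minus[of "- x"])
qed

lemma G_tilde_nonneg:
  assumes "0 \<le> x"
  shows "G_tilde \<nu> (ereal x) u = ereal (interp_cdf (size_bias \<nu>) x u)"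
proof -
  have "(G \<nu> \<longlongrightarrow> ereal (measure (size_bias \<nu>) {..<x})) (at_left (ereal x))"
  \<comment> \<open>To the left of 0 the function \<open>G\<close> integrates over the negative
    half-line, so at \<open>x = 0\<close> the limit has to come from the reflected law.\<close>
  proof (cases "x = 0")
    case True
    then show ?thesis
      using integrable_law.tendsto_G_at_right_0[OF integrable_law_reflection]
        tendsto_G_at_right_iff[of 0 0]
      by (simp only: measure_size_bias_lessThan_0 zero_ereal_def) simp
  qed (use assms in \<open>auto intro: tendsto_G_at_left\<close>)
  moreover have "at_left (ereal x) \<noteq> bot"
    by (simp add: at_left_ereal filtermap_bot_iff trivial_limit_at_left_real)
  ultimately have "Lim (at_left (ereal x)) (G \<nu>) = ereal (measure (size_bias \<nu>) {..<x})"
    by (intro tendsto_Lim)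
  then show ?thesis
    using assms by (simp add: G_tilde_def interp_cdf_def G_ereal)
qed

lemma G_tilde_reflection:
  assumes "0 < x"
  shows "G_tilde (reflection \<nu>) (ereal (- x)) u = G_tilde \<nu> (ereal x) u"
proof -
  have "(G \<nu> \<longlongrightarrow> ereal (measure (size_bias \<nu>) {..<x})) (at_left (ereal x))"
    using assms by (rule tendsto_G_at_left)
  then have "(G (reflection \<nu>) \<longlongrightarrow> ereal (measure (size_bias \<nu>) {..<x})) (at_right (ereal (- x)))"
    by (simp only: tendsto_G_at_right_iff)
  moreover have "at_right (ereal (- x)) \<noteq> bot"
    by (simp add: at_right_ereal filtermap_bot_iff trivial_limit_at_right_real)
  ultimately have "Lim (at_right (ereal (- x))) (G (reflection \<nu>)) = ereal (measure (size_bias \<nu>) {..<x})"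
    by (intro tendsto_Lim)
  then show ?thesis
    using assms G_reflection[of "ereal x"]
    by (simp add: G_tilde_nonneg) (simp add: G_tilde_def interp_cdf_def G_ereal)
qed

lemma recip_nonneg:
  "0 \<le> x \<Longrightarrow> recip \<nu> (ereal x) u = x_minus \<nu> (ereal (interp_cdf (size_bias \<nu>) x u))"
  by (simp add: recip_def G_tilde_nonneg)

lemma recip_reflection:
  assumes "0 < x"
  shows "recip (reflection \<nu>) (ereal (- x)) u = - recip \<nu> (ereal x) u"
  using assms G_tilde_reflection[of x u]
  by (simp add: recip_def x_plus_reflection)

lemma recip_0: "recip \<nu> 0 u = 0"
proof -
  have "recip \<nu> 0 u = x_minus \<nu> 0"
    using recip_nonneg[of 0 u] by (simp add: interp_cdf_def flip: zero_ereal_def)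
  also have "\<dots> = 0"
    unfolding x_minus_def by (rule Sup_eqI) (auto simp: G_def)
  finally show ?thesis .
qed

lemma recip_real_0 [simp]: "recip_real \<nu> 0 u = 0"
  by (simp add: recip_real_def recip_0 flip: zero_ereal_def)

lemma recip_real_reflection: "recip_real (reflection \<nu>) (- x) u = - recip_real \<nu> x u"
proof (cases x "0::real" rule: linorder_cases)
  case less
  then show ?thesis
    using integrable_law.recip_reflection[OF integrable_law_reflection, of "- x" u]
    by (simp add: recip_real_def reflection_reflection)
next
  case equal
  then show ?thesis
    using integrable_law.recip_real_0[OF integrable_law_reflection] by simp
qed (simp add: recip_real_def recip_reflection[simplified])

section \<open>Measurability and sign of the reciprocating function\<close>

text \<open>Raising the level shrinks the set under the supremum, so \<open>x_minus\<close> is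
  antitone in the level and its superlevel sets are intervals.\<close>

lemma borel_measurable_x_minus: "(\<lambda>h. x_minus \<nu> (ereal h)) \<in> borel_measurable borel"
  unfolding borel_measurable_iff_Ici_ereal
proof
  fix a
  have anti: "x_minus \<nu> (ereal k) \<le> x_minus \<nu> (ereal h)" if "h \<le> k" for h k
    unfolding x_minus_def using that by (intro Sup_subset_mono) (auto intro: order_trans[rotated])
  have "is_interval {h. a \<le> x_minus \<nu> (ereal h)}"
    unfolding is_interval_1 using anti by (blast intro: order_trans)
  then show "(\<lambda>h. x_minus \<nu> (ereal h)) -` {a..} \<inter> space borel \<in> sets borel"
    using real_interval_borel_measurable by (simp add: vimage_def)
qed

lemma borel_measurable_x_plus: "(\<lambda>h. x_plus \<nu> (ereal h)) \<in> borel_measurable borel"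
  using integrable_law.borel_measurable_x_minus[OF integrable_law_reflection]
  by (simp add: x_minus_reflection)

lemma borel_measurable_recip_real [measurable (raw)]:
  assumes [measurable]: "f \<in> borel_measurable N" "h \<in> borel_measurable N"
  shows "(\<lambda>x. recip_real \<nu> (f x) (h x)) \<in> borel_measurable N"
proof -
  interpret R: integrable_law "reflection \<nu>" by (rule integrable_law_reflection)
  note [measurable] = measurable_compose[OF _ borel_measurable_x_minus]
    measurable_compose[OF _ R.borel_measurable_x_minus]
  \<comment> \<open>An explicit formula valid on the whole line; negative arguments are routed
    through the reflected law.\<close>
  have "recip_real \<nu> x u = (if 0 \<le> x then real_of_ereal (x_minus \<nu> (ereal (interp_cdf (size_bias \<nu>) x u)))
     else - real_of_ereal (x_minus (reflection \<nu>) (ereal (interp_cdf (size_bias (reflection \<nu>)) (- x) u))))"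
    for x u
    using recip_nonneg[of x u] recip_real_reflection[of x u] R.recip_nonneg[of "- x" u]
    by (auto simp: recip_real_def)
  then show ?thesis by (simp add: measurable_If)
qed

lemma recip_real_nonpos: "0 \<le> x \<Longrightarrow> recip_real \<nu> x u \<le> 0"
proof -
  have "x_minus \<nu> h \<le> 0" for h unfolding x_minus_def by (rule Sup_least) auto
  then show "0 \<le> x \<Longrightarrow> recip_real \<nu> x u \<le> 0"
    by (auto simp: recip_real_def recip_nonneg intro: real_of_ereal_le_0)
qed

text \<open>The sign condition under which the two-point law at \<open>x\<close> and its reciprocal
  has mean zero. It holds everywhere, since \<open>real_of_ereal\<close> turns infinite reciprocals
  into 0.\<close>

lemma mult_recip_real_nonpos: "x * recip_real \<nu> x u \<le> 0"
proof (cases "0 \<le> x")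
  case True
  then show ?thesis using recip_real_nonpos[of x u] by (simp add: mult_nonneg_nonpos)
next
  case False
  then show ?thesis
    using integrable_law.recip_real_nonpos[OF integrable_law_reflection, of "- x" u]
    by (simp add: recip_real_reflection mult_nonpos_nonneg)
qed

section \<open>Recovering the point from its level\<close>

text \<open>A level below the total mass is exceeded at some finite point, which bounds
  \<open>x_plus\<close> from above. Right continuity of the distribution function at 0, where it
  vanishes, keeps a positive level from being reached near 0.\<close>

lemma x_plus_finite:
  assumes "0 < h" "h < measure (size_bias \<nu>) UNIV"
  obtains b where "0 < b" "x_plus \<nu> (ereal h) = ereal b"
proof -
  have "eventually (\<lambda>x. h < cdf (size_bias \<nu>) x) at_top"
    using B.cdf_lim_at_top assms by (intro order_tendstoD(1)) (auto simp: B.borel_UNIV)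
  then have "eventually (\<lambda>x. 0 \<le> x \<and> h < cdf (size_bias \<nu>) x) at_top"
    using eventually_ge_at_top[of "0::real"] by eventually_elim auto
  then obtain y where "0 \<le> y" "h < cdf (size_bias \<nu>) y"
    by (auto dest: eventually_happens)
  then have upper: "x_plus \<nu> (ereal h) \<le> ereal y"
    unfolding x_plus_def by (intro Inf_lower) (auto simp: G_ereal)
  have "(cdf (size_bias \<nu>) \<longlongrightarrow> cdf (size_bias \<nu>) 0) (at_right 0)"
    using B.cdf_is_right_cont[of 0] by (simp only: continuous_within)
  then have "eventually (\<lambda>x. cdf (size_bias \<nu>) x < h) (at_right 0)"
    by (rule order_tendstoD) (use assms in simp)
  then obtain d where d: "0 < d" "\<And>x. 0 < x \<Longrightarrow> x < d \<Longrightarrow> cdf (size_bias \<nu>) x < h"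
    unfolding eventually_at_right_field by auto
  have "ereal (d / 2) \<le> x_plus \<nu> (ereal h)"
    unfolding x_plus_def
  proof (rule Inf_greatest)
    fix x assume x: "x \<in> {x. 0 \<le> x \<and> ereal h \<le> G \<nu> x}"
    show "ereal (d / 2) \<le> x"
    proof (rule ccontr)
      assume "\<not> ereal (d / 2) \<le> x"
      with x obtain r where r: "x = ereal r" "0 \<le> r" "r < d / 2" by (cases x) auto
      have "h \<le> cdf (size_bias \<nu>) r" using x r by (simp add: G_ereal)
      also have "\<dots> \<le> cdf (size_bias \<nu>) (d / 2)" using r by (intro B.cdf_nondecreasing) simp
      also have "\<dots> < h" using d by simp
      finally show False by simp
    qed
  qed
  with upper d(1) that[of "real_of_ereal (x_plus \<nu> (ereal h))"] show ?thesis
    by (cases "x_plus \<nu> (ereal h)") auto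
qed

text \<open>Almost surely the random level is reached at \<open>x\<close> but at no earlier point,
  so \<open>x\<close> is a function of the level. As the reciprocal is \<open>x_minus\<close> of the
  same level, one parameter governs the whole pair.\<close>

lemma AE_x_plus_interp_cdf:
  "AE z in size_bias \<nu> \<Otimes>\<^sub>M uniform01.
     0 < fst z \<and> x_plus \<nu> (ereal (interp_cdf (size_bias \<nu>) (fst z) (snd z))) = ereal (fst z)"
  using B.AE_interp_cdf
proof eventually_elim
  case (elim z)
  obtain x u where z: "z = (x, u)" by (cases z)
  define h where "h = interp_cdf (size_bias \<nu>) x u"
  have h: "0 < h" "h \<le> cdf (size_bias \<nu>) x" "\<And>y. y < x \<Longrightarrow> cdf (size_bias \<nu>) y < h"
    using elim by (auto simp: z h_def)
  have "0 < x"
  proof (rule ccontr)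
    assume "\<not> 0 < x"
    then have "cdf (size_bias \<nu>) x = 0" by simp
    with h show False by simp
  qed
  moreover have "x_plus \<nu> (ereal h) = ereal x"
    unfolding x_plus_def
  proof (rule Inf_eqI)
    fix y assume y: "y \<in> {x. 0 \<le> x \<and> ereal h \<le> G \<nu> x}"
    then show "ereal x \<le> y"
      using h(3) by (cases y) (force simp: G_ereal not_less[symmetric])+
  next
    fix y assume "\<And>i. i \<in> {x. 0 \<le> x \<and> ereal h \<le> G \<nu> x} \<Longrightarrow> y \<le> i"
    then show "y \<le> ereal x" using h(2) \<open>0 < x\<close> by (simp add: G_ereal)
  qed
  ultimately show ?case by (simp add: z h_def)
qed

end

section \<open>Disintegration into two-point laws for nonnegative functions\<close>

text \<open>The closed form of the inner expectation for \<open>a * b \<le> 0\<close>, identified in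
  \<open>ext_integral_two_point\<close>. If \<open>a * b = 0\<close>, both the variable and its
  reciprocal are 0.\<close>

definition two_point_mean :: "(real \<times> real \<Rightarrow> real) \<Rightarrow> real \<Rightarrow> real \<Rightarrow> real" where
  "two_point_mean f a b =
     (if a * b = 0 then f (0, 0) else b / (b - a) * f (a, b) + a / (a - b) * f (b, a))"

lemma borel_measurable_two_point_mean [measurable (raw)]:
  assumes [measurable]: "f \<in> borel_measurable (borel \<Otimes>\<^sub>M borel)"
    "p \<in> borel_measurable N" "q \<in> borel_measurable N"
  shows "(\<lambda>x. two_point_mean f (p x) (q x)) \<in> borel_measurable N"
  unfolding two_point_mean_def by measurable

lemma two_point_mean_commute: "two_point_mean f a b = two_point_mean f b a"
  by (simp add: two_point_mean_def mult.commute add.commute)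

lemma two_point_mean_nonneg:
  assumes "\<And>z. 0 \<le> f z" "a * b \<le> 0"
  shows "0 \<le> two_point_mean f a b"
proof (cases "a * b = 0")
  case False
  then have "a < 0 \<and> 0 < b \<or> b < 0 \<and> 0 < a"
    using assms(2) by (metis linorder_neqE_linordered_idom mult_eq_0_iff mult_neg_neg mult_pos_pos not_less)
  then have "0 \<le> b / (b - a)" "0 \<le> a / (a - b)"
    by (auto intro: divide_nonneg_pos divide_nonpos_neg)
  with assms(1) show ?thesis
    unfolding two_point_mean_def if_not_P[OF False] by (intro add_nonneg_nonneg mult_nonneg_nonneg)
qed (simp add: two_point_mean_def assms)

text \<open>The pointwise identity at one level. Both means have the same value, with denominator
  \<open>b - a\<close>, and the weights add up to \<open>(b - a) / (b * - a)\<close>, so the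
  denominator cancels.\<close>

lemma two_point_mean_disintegration:
  assumes "a < 0" "0 < b"
  shows "1 / b * two_point_mean f b a + 1 / - a * two_point_mean f a b =
    1 / b * f (b, a) + 1 / - a * f (a, b)"
proof -
  have "two_point_mean f b a = (b * f (a, b) + - a * f (b, a)) / (b - a)"
  proof -
    have "a / (a - b) = - a / (b - a)"
      by (metis minus_diff_eq minus_divide_divide)
    then have "two_point_mean f a b = b / (b - a) * f (a, b) + - a / (b - a) * f (b, a)"
      using assms by (simp add: two_point_mean_def)
    then show ?thesis
      by (simp add: two_point_mean_commute[of f b a] diff_divide_distrib)
  qed
  moreover have "two_point_mean f a b = (b * f (a, b) + - a * f (b, a)) / (b - a)"
    using calculation by (simp add: two_point_mean_commute)
  moreover have "1 / b + 1 / - a = (b - a) / (b * - a)"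
    using assms by (simp add: field_simps)
  ultimately have "1 / b * two_point_mean f b a + 1 / - a * two_point_mean f a b =
      (b - a) / (b * - a) * ((b * f (a, b) + - a * f (b, a)) / (b - a))"
    by (simp only: flip: distrib_right)
  also have "\<dots> = 1 / b * f (b, a) + 1 / - a * f (a, b)"
    using assms by (simp add: divide_simps)
  finally show ?thesis .
qed

context integrable_law
begin

text \<open>The two points paired by the common level \<open>h\<close>.\<close>

abbreviation "pos_branch h \<equiv> real_of_ereal (x_plus \<nu> (ereal h))"
abbreviation "neg_branch h \<equiv> real_of_ereal (x_minus \<nu> (ereal h))"

lemma borel_measurable_branches [measurable]:
  "(\<lambda>h. pos_branch h) \<in> borel_measurable borel" "(\<lambda>h. neg_branch h) \<in> borel_measurable borel"
  using borel_measurable_real_of_ereal[OF borel_measurable_x_plus]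
    borel_measurable_real_of_ereal[OF borel_measurable_x_minus] by auto

text \<open>Writing \<open>f\<close> as \<open>x\<close> times \<open>f / x\<close> passes from
  \<open>\<nu>\<close> to \<open>size_bias \<nu>\<close>. There the integrand is almost everywhere a
  function of the level alone, and the level is distributed as Lebesgue measure.\<close>

lemma nn_integral_pos_side:
  assumes [measurable]: "f \<in> borel_measurable (borel \<Otimes>\<^sub>M borel)"
  shows "(\<integral>\<^sup>+z. f (fst z, recip_real \<nu> (fst z) (snd z)) * indicator {0<..} (fst z) \<partial>(\<nu> \<Otimes>\<^sub>M uniform01)) =
    (\<integral>\<^sup>+h\<in>{0<..<measure (size_bias \<nu>) UNIV}.
       ennreal (1 / pos_branch h) * f (pos_branch h, neg_branch h) \<partial>lborel)"
proof -
  interpret U: prob_space uniform01 by (rule prob_space_uniform01)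
  define \<Phi> where "\<Phi> h = ennreal (1 / pos_branch h) * f (pos_branch h, neg_branch h)" for h
  have [measurable]: "\<Phi> \<in> borel_measurable borel" unfolding \<Phi>_def by measurable
  have "(\<integral>\<^sup>+z. f (fst z, recip_real \<nu> (fst z) (snd z)) * indicator {0<..} (fst z) \<partial>(\<nu> \<Otimes>\<^sub>M uniform01)) =
      (\<integral>\<^sup>+x. \<integral>\<^sup>+u. f (x, recip_real \<nu> x u) * indicator {0<..} x \<partial>uniform01 \<partial>\<nu>)"
    by (subst U.nn_integral_fst[symmetric]) auto
  \<comment> \<open>For \<open>x \<le> 0\<close> the factor \<open>ennreal x\<close> is 0 and
    replaces the indicator.\<close>
  also have "\<dots> = (\<integral>\<^sup>+x. ennreal x * (\<integral>\<^sup>+u. ennreal (1 / x) * f (x, recip_real \<nu> x u) \<partial>uniform01) \<partial>\<nu>)"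
  proof (rule nn_integral_cong)
    fix x
    have "ennreal x * (ennreal (1 / x) * c) = c" if "0 < x" for c
    proof -
      have "ennreal x * ennreal (1 / x) = 1" using that by (simp flip: ennreal_mult)
      then show ?thesis by (simp flip: mult.assoc)
    qed
    then show "(\<integral>\<^sup>+u. f (x, recip_real \<nu> x u) * indicator {0<..} x \<partial>uniform01) =
        ennreal x * (\<integral>\<^sup>+u. ennreal (1 / x) * f (x, recip_real \<nu> x u) \<partial>uniform01)"
      by (cases "0 < x") (simp_all add: ennreal_neg flip: nn_integral_cmult)
  qed
  also have "\<dots> = (\<integral>\<^sup>+x. \<integral>\<^sup>+u. ennreal (1 / x) * f (x, recip_real \<nu> x u) \<partial>uniform01 \<partial>size_bias \<nu>)"
    unfolding size_bias_def by (subst nn_integral_density) auto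
  also have "\<dots> = (\<integral>\<^sup>+z. ennreal (1 / fst z) * f (fst z, recip_real \<nu> (fst z) (snd z)) \<partial>(size_bias \<nu> \<Otimes>\<^sub>M uniform01))"
    by (subst U.nn_integral_fst[symmetric]) auto
  also have "\<dots> = (\<integral>\<^sup>+z. \<Phi> (interp_cdf (size_bias \<nu>) (fst z) (snd z)) \<partial>(size_bias \<nu> \<Otimes>\<^sub>M uniform01))"
    using AE_x_plus_interp_cdf
    by (intro nn_integral_cong_AE, eventually_elim) (auto simp: \<Phi>_def recip_real_def recip_nonneg)
  also have "\<dots> = (\<integral>\<^sup>+h. \<Phi> h \<partial>distr (size_bias \<nu> \<Otimes>\<^sub>M uniform01) borel (\<lambda>(x, u). interp_cdf (size_bias \<nu>) x u))"
    by (subst nn_integral_distr) (auto simp: case_prod_beta)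
  also have "\<dots> = (\<integral>\<^sup>+h\<in>{0<..<measure (size_bias \<nu>) UNIV}. \<Phi> h \<partial>lborel)"
    unfolding B.distr_interp_cdf by (subst nn_integral_density) (auto simp: mult.commute)
  finally show ?thesis unfolding \<Phi>_def .
qed

text \<open>The positive side of the reflected law, applied to \<open>f\<close> with both arguments
  negated.\<close>

lemma nn_integral_neg_side:
  assumes [measurable]: "f \<in> borel_measurable (borel \<Otimes>\<^sub>M borel)"
  shows "(\<integral>\<^sup>+z. f (fst z, recip_real \<nu> (fst z) (snd z)) * indicator {..<0} (fst z) \<partial>(\<nu> \<Otimes>\<^sub>M uniform01)) =
    (\<integral>\<^sup>+h\<in>{0<..<measure (size_bias (reflection \<nu>)) UNIV}.
       ennreal (1 / - neg_branch h) * f (neg_branch h, pos_branch h) \<partial>lborel)"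
proof -
  interpret U: prob_space uniform01 by (rule prob_space_uniform01)
  interpret R: integrable_law "reflection \<nu>" by (rule integrable_law_reflection)
  have "(\<integral>\<^sup>+z. f (fst z, recip_real \<nu> (fst z) (snd z)) * indicator {..<0} (fst z) \<partial>(\<nu> \<Otimes>\<^sub>M uniform01)) =
      (\<integral>\<^sup>+x. \<integral>\<^sup>+u. f (x, recip_real \<nu> x u) * indicator {..<0} x \<partial>uniform01 \<partial>\<nu>)"
    by (subst U.nn_integral_fst[symmetric]) auto
  also have "\<dots> = (\<integral>\<^sup>+x. \<integral>\<^sup>+u. f (- x, - recip_real (reflection \<nu>) x u) * indicator {0<..} x \<partial>uniform01 \<partial>reflection \<nu>)"
  proof -
    have "(\<lambda>x. \<integral>\<^sup>+u. f (- x, - recip_real (reflection \<nu>) x u) * indicator {0<..} x \<partial>uniform01) \<in> borel_measurable borel"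
      by measurable
    then have "(\<integral>\<^sup>+x. \<integral>\<^sup>+u. f (- x, - recip_real (reflection \<nu>) x u) * indicator {0<..} x \<partial>uniform01 \<partial>reflection \<nu>) =
      (\<integral>\<^sup>+x. \<integral>\<^sup>+u. f (- (- x), - recip_real (reflection \<nu>) (- x) u) * indicator {0<..} (- x) \<partial>uniform01 \<partial>\<nu>)"
      unfolding reflection_def by (subst nn_integral_distr) auto
    then show ?thesis
      by (simp add: recip_real_reflection indicator_def)
  qed
  also have "\<dots> = (\<integral>\<^sup>+z. f (- fst z, - recip_real (reflection \<nu>) (fst z) (snd z)) * indicator {0<..} (fst z)
      \<partial>(reflection \<nu> \<Otimes>\<^sub>M uniform01))"
    by (subst U.nn_integral_fst[symmetric]) auto
  also have "\<dots> = (\<integral>\<^sup>+h\<in>{0<..<measure (size_bias (reflection \<nu>)) UNIV}.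
       ennreal (1 / - neg_branch h) * f (neg_branch h, pos_branch h) \<partial>lborel)"
    using R.nn_integral_pos_side[of "\<lambda>(x, y). f (- x, - y)"]
    by (simp add: x_plus_reflection x_minus_reflection)
  finally show ?thesis .
qed

text \<open>Mean zero says that the positive and negative parts have equal expectation. Hence the
  level integrals of both sides run over the same interval and can be merged.\<close>

lemma measure_size_bias_reflection:
  assumes "integral\<^sup>L \<nu> (\<lambda>x. x) = 0"
  shows "measure (size_bias (reflection \<nu>)) UNIV = measure (size_bias \<nu>) UNIV"
proof -
  have "emeasure (size_bias \<nu>) UNIV = (\<integral>\<^sup>+x. ennreal x \<partial>\<nu>)"
    by (simp add: size_bias_def emeasure_density)
  moreover have "emeasure (size_bias (reflection \<nu>)) UNIV = (\<integral>\<^sup>+x. ennreal (- x) \<partial>\<nu>)"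
    by (simp add: size_bias_def reflection_def emeasure_density nn_integral_distr)
  ultimately show ?thesis
    using assms real_lebesgue_integral_def[OF integrable_id] by (simp add: measure_def)
qed

lemma nn_integral_recip_real:
  assumes "integral\<^sup>L \<nu> (\<lambda>x. x) = 0"
    and [measurable]: "f \<in> borel_measurable (borel \<Otimes>\<^sub>M borel)"
  shows "(\<integral>\<^sup>+z. f (fst z, recip_real \<nu> (fst z) (snd z)) \<partial>(\<nu> \<Otimes>\<^sub>M uniform01)) =
    f (0, 0) * emeasure (\<nu> \<Otimes>\<^sub>M uniform01) {z. fst z = 0} +
    (\<integral>\<^sup>+h\<in>{0<..<measure (size_bias \<nu>) UNIV}. (ennreal (1 / pos_branch h) * f (pos_branch h, neg_branch h) +
       ennreal (1 / - neg_branch h) * f (neg_branch h, pos_branch h)) \<partial>lborel)"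
proof -
  have "{z \<in> space (\<nu> \<Otimes>\<^sub>M uniform01). fst z = 0} \<in> sets (\<nu> \<Otimes>\<^sub>M uniform01)" by measurable
  then have zero: "{z. fst z = 0} \<in> sets (\<nu> \<Otimes>\<^sub>M uniform01)"
    by (simp add: space_pair_measure)
  let ?f = "\<lambda>z. f (fst z, recip_real \<nu> (fst z) (snd z))"
  have "?f z = f (0, 0) * indicator {z. fst z = 0} z +
      (?f z * indicator {0<..} (fst z) + ?f z * indicator {..<0} (fst z))" for z
    by (cases "fst z" "0::real" rule: linorder_cases) auto
  then have "(\<integral>\<^sup>+z. ?f z \<partial>(\<nu> \<Otimes>\<^sub>M uniform01)) =
      (\<integral>\<^sup>+z. f (0, 0) * indicator {z. fst z = 0} z + (?f z * indicator {0<..} (fst z) +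
        ?f z * indicator {..<0} (fst z)) \<partial>(\<nu> \<Otimes>\<^sub>M uniform01))"
    by simp
  also have "\<dots> = (\<integral>\<^sup>+z. f (0, 0) * indicator {z. fst z = 0} z \<partial>(\<nu> \<Otimes>\<^sub>M uniform01)) +
     ((\<integral>\<^sup>+z. ?f z * indicator {0<..} (fst z) \<partial>(\<nu> \<Otimes>\<^sub>M uniform01)) +
      (\<integral>\<^sup>+z. ?f z * indicator {..<0} (fst z) \<partial>(\<nu> \<Otimes>\<^sub>M uniform01)))"
    using zero by (simp add: nn_integral_add)
  finally show ?thesis
    using zero
    by (simp add: nn_integral_cmult_indicator nn_integral_pos_side nn_integral_neg_side
        measure_size_bias_reflection[OF assms(1)] distrib_right flip: nn_integral_add)
qed

text \<open>The level representation is applied both to \<open>f\<close> and to its two-point mean;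
  the integrands agree at each level, and at the origin both functions equal
  \<open>f (0, 0)\<close>.\<close>

lemma nn_integral_two_point_mean:
  assumes mean: "integral\<^sup>L \<nu> (\<lambda>x. x) = 0"
    and [measurable]: "f \<in> borel_measurable (borel \<Otimes>\<^sub>M borel)" and nonneg: "\<And>z. 0 \<le> f z"
  shows "(\<integral>\<^sup>+z. ennreal (f (fst z, recip_real \<nu> (fst z) (snd z))) \<partial>(\<nu> \<Otimes>\<^sub>M uniform01)) =
    (\<integral>\<^sup>+z. ennreal (two_point_mean f (fst z) (recip_real \<nu> (fst z) (snd z))) \<partial>(\<nu> \<Otimes>\<^sub>M uniform01))"
proof -
  interpret R: integrable_law "reflection \<nu>" by (rule integrable_law_reflection)
  let ?H = "\<lambda>z. ennreal (two_point_mean f (fst z) (snd z))"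
  have "ennreal (1 / pos_branch h) * ennreal (f (pos_branch h, neg_branch h)) +
      ennreal (1 / - neg_branch h) * ennreal (f (neg_branch h, pos_branch h)) =
    ennreal (1 / pos_branch h) * ?H (pos_branch h, neg_branch h) +
      ennreal (1 / - neg_branch h) * ?H (neg_branch h, pos_branch h)"
    if h: "0 < h" "h < measure (size_bias \<nu>) UNIV" for h
  proof -
    obtain b where b: "0 < b" "x_plus \<nu> (ereal h) = ereal b" using x_plus_finite[OF h] .
    \<comment> \<open>The negative partner of \<open>b\<close> is the negated positive quantile of
      the reflected law; mean zero puts \<open>h\<close> in range for that law too.\<close>
    obtain a' where "0 < a'" "x_plus (reflection \<nu>) (ereal h) = ereal a'"
      using R.x_plus_finite[of h] h measure_size_bias_reflection[OF mean] by auto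
    then obtain a where a: "a < 0" "x_minus \<nu> (ereal h) = ereal a"
      by (intro that[of "- a'"]) (auto simp: x_plus_reflection ereal_uminus_eq_reorder)
    have "0 \<le> two_point_mean f a b" "0 \<le> two_point_mean f b a"
      using a b nonneg by (auto intro!: two_point_mean_nonneg simp: mult_le_0_iff)
    moreover have "ennreal (1 / b) * ennreal p + ennreal (1 / - a) * ennreal q =
        ennreal (1 / b * p + 1 / - a * q)" if "0 \<le> p" "0 \<le> q" for p q
    proof -
      have "0 \<le> 1 / b" "0 \<le> 1 / - a" using a b by auto
      with that show ?thesis by (simp only: ennreal_mult ennreal_plus mult_nonneg_nonneg)
    qed
    ultimately show ?thesis
      by (simp only: a b real_of_ereal.simps fst_conv snd_conv nonneg
          two_point_mean_disintegration[OF a(1) b(1)])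
  qed
  then have "(\<integral>\<^sup>+h\<in>{0<..<measure (size_bias \<nu>) UNIV}. (ennreal (1 / pos_branch h) * ennreal (f (pos_branch h, neg_branch h)) +
       ennreal (1 / - neg_branch h) * ennreal (f (neg_branch h, pos_branch h))) \<partial>lborel) =
    (\<integral>\<^sup>+h\<in>{0<..<measure (size_bias \<nu>) UNIV}. (ennreal (1 / pos_branch h) * ?H (pos_branch h, neg_branch h) +
       ennreal (1 / - neg_branch h) * ?H (neg_branch h, pos_branch h)) \<partial>lborel)"
    by (intro nn_integral_cong) (auto simp: indicator_def)
  then show ?thesis
    using nn_integral_recip_real[OF mean, of "\<lambda>z. ennreal (f z)"] nn_integral_recip_real[OF mean, of ?H]
    by (simp add: two_point_mean_def[of f 0 0])
qed

end

section \<open>Signed functions\<close>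

text \<open>Positive and negative parts are compared by an additive identity in
  \<open>ennreal\<close>, which avoids subtracting infinities. The negative part of the sum is
  dominated by that of \<open>l\<close>, hence has finite integral.\<close>

lemma quasi_integrable_ereal_add:
  fixes k l :: "'a \<Rightarrow> real"
  assumes [measurable]: "k \<in> borel_measurable M" and k: "\<And>x. 0 \<le> k x" and l: "integrable M l"
  shows "quasi_integrable M (\<lambda>x. ereal (k x + l x)) \<and>
    ext_integral M (\<lambda>x. ereal (k x + l x)) = enn2ereal (\<integral>\<^sup>+x. ennreal (k x) \<partial>M) + ereal (integral\<^sup>L M l)"
proof -
  have [measurable]: "l \<in> borel_measurable M" using l by simp
  define A B K where "A = (\<integral>\<^sup>+x. ennreal (k x + l x) \<partial>M)"
    and "B = (\<integral>\<^sup>+x. ennreal (- (k x + l x)) \<partial>M)" and "K = (\<integral>\<^sup>+x. ennreal (k x) \<partial>M)"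
  define p q where "p = enn2real (\<integral>\<^sup>+x. ennreal (l x) \<partial>M)"
    and "q = enn2real (\<integral>\<^sup>+x. ennreal (- l x) \<partial>M)"
  have pq: "0 \<le> p" "0 \<le> q" "(\<integral>\<^sup>+x. ennreal (l x) \<partial>M) = ennreal p"
      "(\<integral>\<^sup>+x. ennreal (- l x) \<partial>M) = ennreal q" "integral\<^sup>L M l = p - q"
    using l real_lebesgue_integral_def[OF l]
    by (auto simp: p_def q_def real_integrable_def less_top)
  have "B \<le> (\<integral>\<^sup>+x. ennreal (- l x) \<partial>M)"
    unfolding B_def using k by (intro nn_integral_mono ennreal_leI) simp
  then obtain b where b: "B = ennreal b" "0 \<le> b"
    using pq by (cases B) (auto simp: top_unique)
  \<comment> \<open>As \<open>ennreal\<close> is the positive part, this is the rearranged form of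
    \<open>k + l\<close> being the difference of its two parts.\<close>
  have "ennreal (k x + l x) + ennreal (- l x) = ennreal (k x) + ennreal (l x) + ennreal (- (k x + l x))" for x
  proof -
    consider "0 \<le> l x" | "l x < 0" "0 \<le> k x + l x" | "l x < 0" "k x + l x < 0" by linarith
    then show ?thesis
      using k[of x] by cases (simp_all add: ennreal_neg flip: ennreal_plus)
  qed
  then have eq: "A + ennreal q = K + ennreal p + B"
    unfolding A_def B_def K_def pq(3,4)[symmetric] by (simp flip: nn_integral_add)
  have "enn2ereal A - enn2ereal B = enn2ereal K + ereal (p - q)"
  proof (cases K)
    case (real r)
    then have "A + ennreal q = ennreal (r + p + b)"
      using eq b pq by simp
    moreover obtain a where a: "A = ennreal a" "0 \<le> a"
      using calculation by (cases A) auto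
    ultimately have "a + q = r + p + b"
      using pq real b by (simp flip: ennreal_plus)
    then show ?thesis
      using a b real by simp
  next
    case top
    then have "A = top" using eq by (cases A) (auto simp flip: ennreal_plus)
    then show ?thesis using top b by simp
  qed
  then show ?thesis
    using b pq by (simp add: quasi_integrable_def ext_integral_def A_def B_def K_def)
qed

text \<open>Quasi-integrability excludes the difference of two infinities, which is infinity in
  \<open>ereal\<close> and would break antisymmetry.\<close>

lemma quasi_integrable_uminus:
  assumes "quasi_integrable M f"
  shows "quasi_integrable M (\<lambda>x. - f x)" "ext_integral M (\<lambda>x. - f x) = - ext_integral M f"
proof -
  show "quasi_integrable M (\<lambda>x. - f x)"
    using assms by (auto simp: quasi_integrable_def)
  have "enn2ereal b - enn2ereal a = - (enn2ereal a - enn2ereal b)"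
    if "a < \<infinity> \<or> b < \<infinity>" for a b :: ennreal
    using that by (cases a; cases b) auto
  with assms show "ext_integral M (\<lambda>x. - f x) = - ext_integral M f"
    unfolding quasi_integrable_def ext_integral_def by simp
qed

lemma quasi_integrable_distr:
  assumes [measurable]: "T \<in> measurable M N" and "quasi_integrable (distr M N T) f"
  shows "quasi_integrable M (\<lambda>x. f (T x))" "ext_integral M (\<lambda>x. f (T x)) = ext_integral (distr M N T) f"
proof -
  have [measurable]: "f \<in> borel_measurable N"
    using assms(2) by (simp add: quasi_integrable_def)
  show "quasi_integrable M (\<lambda>x. f (T x))" "ext_integral M (\<lambda>x. f (T x)) = ext_integral (distr M N T) f"
    using assms(2) by (simp_all add: quasi_integrable_def ext_integral_def nn_integral_distr)
qed

text \<open>The two-point law has mean zero, which removes \<open>c * x\<close>, and its weights sum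
  to 1, which keeps \<open>d\<close>.\<close>

lemma two_point_mean_add_affine:
  assumes "\<And>x y. f (x, y) = k (x, y) + (c * x + d)" "a * b \<le> 0"
  shows "two_point_mean f a b = two_point_mean k a b + d"
proof (cases "a * b = 0")
  case False
  then have ab: "b - a \<noteq> 0"
    using assms(2) by (auto simp: mult_le_0_iff)
  have "a / (a - b) = - a / (b - a)"
    by (metis minus_diff_eq minus_divide_divide)
  then have mean: "two_point_mean h a b = (b * h (a, b) - a * h (b, a)) / (b - a)" for h
    using False by (simp add: two_point_mean_def diff_divide_distrib)
  have "b * f (a, b) - a * f (b, a) = b * k (a, b) - a * k (b, a) + d * (b - a)"
    by (simp add: assms(1) algebra_simps)
  with ab show ?thesis
    by (simp add: mean add_divide_distrib)
qed (use assms in \<open>auto simp: two_point_mean_def\<close>)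

lemma two_point_mean_uminus: "two_point_mean (\<lambda>z. - f z) a b = - two_point_mean f a b"
  by (simp add: two_point_mean_def)

text \<open>Write \<open>f\<close> as a nonnegative \<open>k\<close> plus the affine function
  \<open>c * x + d\<close>. The nonnegative case handles \<open>k\<close>, and the affine part
  contributes \<open>d\<close> to both sides because \<open>\<nu>\<close> has mean zero.\<close>

lemma (in integrable_law) ext_integral_recip_real:
  assumes mean: "integral\<^sup>L \<nu> (\<lambda>x. x) = 0"
    and [measurable]: "f \<in> borel_measurable (borel \<Otimes>\<^sub>M borel)"
    and lower: "\<And>x y. d \<le> f (x, y) - c * x"
  defines "P \<equiv> \<nu> \<Otimes>\<^sub>M uniform01"
  shows "quasi_integrable P (\<lambda>z. ereal (f (fst z, recip_real \<nu> (fst z) (snd z)))) \<and>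
    quasi_integrable P (\<lambda>z. ereal (two_point_mean f (fst z) (recip_real \<nu> (fst z) (snd z)))) \<and>
    ext_integral P (\<lambda>z. ereal (f (fst z, recip_real \<nu> (fst z) (snd z)))) =
      ext_integral P (\<lambda>z. ereal (two_point_mean f (fst z) (recip_real \<nu> (fst z) (snd z))))"
proof -
  interpret U: prob_space uniform01 by (rule prob_space_uniform01)
  interpret pair_prob_space \<nu> uniform01 ..
  have prob: "measure P (space P) = 1"
    unfolding P_def by (rule P.prob_space)
  have [measurable_cong]: "sets P = sets (borel \<Otimes>\<^sub>M borel)"
    unfolding P_def by (intro sets_pair_measure_cong) auto
  define k where "k z = f z - c * fst z - d" for z
  have [measurable]: "k \<in> borel_measurable (borel \<Otimes>\<^sub>M borel)" unfolding k_def by measurable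
  have k: "0 \<le> k z" for z using lower[of "fst z" "snd z"] by (simp add: k_def)
  have fst: "integrable P fst" "integral\<^sup>L P fst = 0"
  proof -
    have d: "distr P \<nu> fst = \<nu>" unfolding P_def by (rule U.distr_pair_fst)
    have meas: "fst \<in> measurable P \<nu>" unfolding P_def by (rule measurable_fst)
    show "integrable P fst"
      using integrable_distr[OF meas, of "\<lambda>x. x"] integrable_id by (simp only: d)
    show "integral\<^sup>L P fst = 0"
      using integral_distr[OF meas, of "\<lambda>x. x"] mean by (simp only: d) simp
  qed
  let ?r = "\<lambda>z. recip_real \<nu> (fst z) (snd z)"
  have f: "f (fst z, ?r z) = k (fst z, ?r z) + (c * fst z + d)" for z
    by (simp add: k_def)
  have H: "two_point_mean f (fst z) (?r z) = two_point_mean k (fst z) (?r z) + d" for z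
    by (rule two_point_mean_add_affine[OF _ mult_recip_real_nonpos, where c = c]) (simp add: k_def)
  have const: "integrable P (\<lambda>z. d)"
    unfolding P_def by (rule P.integrable_const)
  have "integral\<^sup>L P (\<lambda>z. d) = d"
    by (simp add: prob)
  moreover have "integral\<^sup>L P (\<lambda>z. c * fst z + d) = c * integral\<^sup>L P fst + integral\<^sup>L P (\<lambda>z. d)"
    using fst(1) const by (subst Bochner_Integration.integral_add) auto
  ultimately have int: "integrable P (\<lambda>z. c * fst z + d)" "integral\<^sup>L P (\<lambda>z. c * fst z + d) = d"
      "integral\<^sup>L P (\<lambda>z. d) = d"
    using fst const by simp_all
  have "0 \<le> two_point_mean k (fst z) (?r z)" for z
    by (intro two_point_mean_nonneg k mult_recip_real_nonpos)
  then have "quasi_integrable P (\<lambda>z. ereal (two_point_mean f (fst z) (?r z)))"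
    and "ext_integral P (\<lambda>z. ereal (two_point_mean f (fst z) (?r z))) =
      enn2ereal (\<integral>\<^sup>+z. ennreal (two_point_mean k (fst z) (?r z)) \<partial>P) + ereal d"
    using quasi_integrable_ereal_add[of "\<lambda>z. two_point_mean k (fst z) (?r z)" P "\<lambda>z. d"] const
    by (simp_all only: H int) measurable
  moreover have "quasi_integrable P (\<lambda>z. ereal (f (fst z, ?r z)))"
    and "ext_integral P (\<lambda>z. ereal (f (fst z, ?r z))) =
      enn2ereal (\<integral>\<^sup>+z. ennreal (k (fst z, ?r z)) \<partial>P) + ereal d"
    using quasi_integrable_ereal_add[of "\<lambda>z. k (fst z, ?r z)" P "\<lambda>z. c * fst z + d"] k int(1)
    by (simp_all only: f int) measurable
  moreover have "(\<integral>\<^sup>+z. ennreal (k (fst z, ?r z)) \<partial>P) =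
      (\<integral>\<^sup>+z. ennreal (two_point_mean k (fst z) (?r z)) \<partial>P)"
    unfolding P_def by (rule nn_integral_two_point_mean[OF mean _ k]) measurable
  ultimately show ?thesis by simp
qed

section \<open>Two-point laws\<close>

lemma integrable_law_two_point: "integrable_law (two_point a b)"
proof -
  have "real_distribution (two_point a b)"
    unfolding two_point_def by (rule prob_space.real_distribution_distr) (auto intro: measure_pmf.prob_space_axioms)
  moreover have "integrable (two_point a b) (\<lambda>x. x)"
    unfolding two_point_def
    by (subst integrable_distr_eq) (auto intro: integrable_measure_pmf_finite)
  ultimately show ?thesis
    by (simp add: integrable_law_def integrable_law_axioms_def)
qed

lemma sets_two_point [simp, measurable_cong]: "sets (two_point a b) = sets borel"
  by (simp add: two_point_def)

text \<open>The bounds on the weight matter because \<open>bernoulli_pmf\<close> clamps its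
  parameter to the unit interval.\<close>

lemma nn_integral_two_point:
  assumes "0 \<le> b / (b - a)" "b / (b - a) \<le> 1" and [measurable]: "f \<in> borel_measurable borel"
  shows "(\<integral>\<^sup>+x. f x \<partial>two_point a b) =
    ennreal (b / (b - a)) * f a + ennreal (1 - b / (b - a)) * f b"
  unfolding two_point_def using assms(1,2)
  by (subst nn_integral_distr) (auto simp: mult.commute)

lemma two_point_weight:
  fixes a b :: real
  assumes "a * b < 0"
  shows "0 \<le> b / (b - a)" "b / (b - a) \<le> 1" "1 - b / (b - a) = a / (a - b)"
proof -
  have "a < 0 \<and> 0 < b \<or> b < 0 \<and> 0 < a" using assms by (simp add: mult_less_0_iff) blast
  then show "0 \<le> b / (b - a)" "b / (b - a) \<le> 1" "1 - b / (b - a) = a / (a - b)"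
    by (auto simp: divide_simps) (auto simp: algebra_simps)
qed

text \<open>Allows the negative atom to be listed first.\<close>

lemma two_point_commute:
  assumes "a * b < 0"
  shows "two_point a b = two_point b a"
proof (rule measure_eqI)
  fix A assume "A \<in> sets (two_point a b)"
  then have A: "A \<in> sets borel" by simp
  have ba: "b * a < 0" using assms by (simp add: mult.commute)
  have "1 - a / (a - b) = b / (b - a)" using two_point_weight(3)[OF ba] .
  with A show "emeasure (two_point a b) A = emeasure (two_point b a) A"
    using nn_integral_two_point[OF two_point_weight(1,2)[OF assms], of "indicator A"]
      nn_integral_two_point[OF two_point_weight(1,2)[OF ba], of "indicator A"]
    by (simp add: two_point_weight(3)[OF assms] add.commute)
qed simp

lemma reflection_two_point:
  assumes "a * b < 0"
  shows "reflection (two_point a b) = two_point (- b) (- a)"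
proof -
  have "b / (b - a) = - b / (- b - - a)"
    by (metis minus_diff_minus minus_divide_divide minus_minus)
  then have "reflection (two_point a b) = two_point (- a) (- b)"
    unfolding reflection_def two_point_def by (subst distr_distr) (auto intro!: distr_cong)
  also have "\<dots> = two_point (- b) (- a)"
    by (rule two_point_commute) (use assms in simp)
  finally show ?thesis .
qed

text \<open>Size biasing deletes the negative atom and leaves a single atom at \<open>b\<close>,
  with mass \<open>b\<close> times its probability.\<close>

lemma measure_size_bias_two_point:
  assumes ab: "a < 0" "0 < b" and A: "A \<in> sets borel"
  shows "measure (size_bias (two_point a b)) A = - a / (b - a) * b * indicator A b"
proof -
  have neg: "a * b < 0" using ab by (simp add: mult_neg_pos)
  have w: "1 - b / (b - a) = - a / (b - a)" using ab by (simp add: divide_simps)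
  have "emeasure (size_bias (two_point a b)) A = (\<integral>\<^sup>+x. ennreal x * indicator A x \<partial>two_point a b)"
    using A by (simp add: size_bias_def emeasure_density)
  also have "\<dots> = ennreal (- a / (b - a)) * (ennreal b * indicator A b)"
    using A ab by (subst nn_integral_two_point[OF two_point_weight(1,2)[OF neg]]) (auto simp: w ennreal_neg)
  also have "\<dots> = ennreal (- a / (b - a) * b * indicator A b)"
    using ennreal_mult[of "- a / (b - a)" b] ab by (cases "b \<in> A") (simp_all add: divide_nonpos_pos)
  finally have "emeasure (size_bias (two_point a b)) A = ennreal (- a / (b - a) * b * indicator A b)" .
  moreover have "0 \<le> - a / (b - a) * b * indicator A b"
    using ab by (intro mult_nonneg_nonneg divide_nonneg_pos) auto
  ultimately show ?thesis
    by (simp only: measure_def enn2real_ennreal)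
qed

text \<open>On the positive half-line \<open>G\<close> is one step at \<open>b\<close>, so each
  positive level up to the step height is first reached at \<open>b\<close>.\<close>

lemma x_plus_two_point:
  assumes ab: "a < 0" "0 < b" and h: "0 < h" "h \<le> - a / (b - a) * b"
  shows "x_plus (two_point a b) (ereal h) = ereal b"
proof -
  interpret integrable_law "two_point a b" by (rule integrable_law_two_point)
  have "{x. 0 \<le> x \<and> ereal h \<le> G (two_point a b) x} = {ereal b..}"
  proof (intro set_eqI)
    fix x :: ereal
    show "x \<in> {x. 0 \<le> x \<and> ereal h \<le> G (two_point a b) x} \<longleftrightarrow> x \<in> {ereal b..}"
    proof (cases x)
      case (real r)
      have "r < 0 \<Longrightarrow> \<not> ereal b \<le> x" using ab real by simp
      then show ?thesis
        using ab h real by (cases "0 \<le> r") (auto simp: G_ereal cdf_def measure_size_bias_two_point indicator_def)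
    qed (use ab h in \<open>auto simp: G_PInf measure_size_bias_two_point\<close>)
  qed
  then show ?thesis unfolding x_plus_def by (simp add: Inf_atLeast)
qed

lemma recip_real_two_point_pos:
  assumes ab: "a < 0" "0 < b" and u: "0 < u" "u \<le> 1"
  shows "recip_real (two_point a b) b u = a"
proof -
  interpret integrable_law "two_point a b" by (rule integrable_law_two_point)
  let ?m = "- a / (b - a) * b"
  have m: "0 < ?m" using ab by (simp add: divide_neg_pos mult_neg_pos)
  have "x_plus (two_point (- b) (- a)) (ereal (?m * u)) = ereal (- a)"
  proof (rule x_plus_two_point)
    show "0 < ?m * u" by (rule mult_pos_pos[OF m u(1)])
    have "?m * u \<le> ?m * 1" using m u by (intro mult_left_mono) auto
    \<comment> \<open>The reflected law has the same step height, being symmetric in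
      \<open>- a\<close> and \<open>b\<close>.\<close>
    then show "?m * u \<le> - (- b) / (- a - - b) * - a" by (simp add: mult.commute)
  qed (use ab in auto)
  then have "- x_minus (two_point a b) (ereal (?m * u)) = ereal (- a)"
    using x_plus_reflection[of "ereal (?m * u)"] ab by (simp add: reflection_two_point mult_neg_pos)
  then have "- (- x_minus (two_point a b) (ereal (?m * u))) = - ereal (- a)"
    by (rule arg_cong)
  then have "x_minus (two_point a b) (ereal (?m * u)) = ereal a"
    by (simp only: ereal_uminus_uminus uminus_ereal.simps minus_minus)
  moreover have "interp_cdf (size_bias (two_point a b)) b u = ?m * u"
    using ab by (simp add: interp_cdf_def cdf_def measure_size_bias_two_point)
  ultimately show ?thesis
    using ab by (simp add: recip_real_def recip_nonneg)
qed

lemma recip_real_two_point: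
  assumes ab: "a * b < 0" and u: "0 < u" "u \<le> 1"
  shows "recip_real (two_point a b) a u = b" "recip_real (two_point a b) b u = a"
proof -
  have *: "recip_real (two_point a b) a u = b \<and> recip_real (two_point a b) b u = a"
    if "a < 0" "0 < b" for a b
  proof -
    interpret integrable_law "two_point a b" by (rule integrable_law_two_point)
    have "recip_real (two_point a b) a u = - recip_real (reflection (two_point a b)) (- a) u"
      by (simp add: recip_real_reflection)
    also have "\<dots> = b"
      using that u by (simp add: reflection_two_point mult_neg_pos recip_real_two_point_pos)
    finally show ?thesis using that u by (simp add: recip_real_two_point_pos)
  qed
  have "a < 0 \<and> 0 < b \<or> b < 0 \<and> 0 < a" using ab by (simp add: mult_less_0_iff) blast
  then show "recip_real (two_point a b) a u = b" "recip_real (two_point a b) b u = a"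
    using *[of a b] *[of b a] two_point_commute[OF ab] by auto
qed

text \<open>This is the integral of the positive part; the negative part follows by inserting
  \<open>- f\<close> for \<open>f\<close>.\<close>

lemma nn_integral_two_point_fun:
  assumes ab: "a * b \<le> 0" and [measurable]: "f \<in> borel_measurable (borel \<Otimes>\<^sub>M borel)"
  shows "(\<integral>\<^sup>+z. e2ennreal (two_point_fun f a b z) \<partial>two_point_space a b) =
    (if a * b = 0 then ennreal (f (0, 0))
     else ennreal (b / (b - a)) * ennreal (f (a, b)) + ennreal (a / (a - b)) * ennreal (f (b, a)))"
proof -
  interpret U: prob_space uniform01 by (rule prob_space_uniform01)
  interpret integrable_law "two_point a b" by (rule integrable_law_two_point)
  let ?r = "recip_real (two_point a b)"
  have weight: "0 \<le> b / (b - a)" "b / (b - a) \<le> 1"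
    using two_point_weight[of a b] ab by (cases "a * b = 0"; force simp: divide_simps)+
  have "(\<integral>\<^sup>+z. e2ennreal (two_point_fun f a b z) \<partial>two_point_space a b) =
      (\<integral>\<^sup>+y. \<integral>\<^sup>+v. ennreal (f (y, ?r y v)) \<partial>uniform01 \<partial>two_point a b)"
    unfolding two_point_space_def two_point_fun_def
    by (subst U.nn_integral_fst[symmetric]) auto
  also have "\<dots> = ennreal (b / (b - a)) * (\<integral>\<^sup>+v. ennreal (f (a, ?r a v)) \<partial>uniform01) +
      ennreal (1 - b / (b - a)) * (\<integral>\<^sup>+v. ennreal (f (b, ?r b v)) \<partial>uniform01)"
    by (rule nn_integral_two_point[OF weight]) measurable
  also have "\<dots> = (if a * b = 0 then ennreal (f (0, 0))
     else ennreal (b / (b - a)) * ennreal (f (a, b)) + ennreal (a / (a - b)) * ennreal (f (b, a)))"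
  \<comment> \<open>In the degenerate case all weight sits on an atom equal to 0: the weight of
    \<open>a\<close> is 1 if only \<open>a\<close> is 0, and 0 if \<open>b\<close> is 0, also for
    \<open>0 / 0\<close>.\<close>
  proof (cases "a * b = 0")
    case True
    then show ?thesis
      using U.emeasure_space_1
      by (cases "a = 0"; cases "b = 0") (auto simp: integrable_law.recip_real_0[OF integrable_law_two_point])
  next
    case False
    with ab have neg: "a * b < 0" by (rule le_neq_trans)
    have "(\<integral>\<^sup>+v. ennreal (f (a, ?r a v)) \<partial>uniform01) = (\<integral>\<^sup>+v. ennreal (f (a, b)) \<partial>uniform01)"
      "(\<integral>\<^sup>+v. ennreal (f (b, ?r b v)) \<partial>uniform01) = (\<integral>\<^sup>+v. ennreal (f (b, a)) \<partial>uniform01)"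
      using AE_uniform01
      by (intro nn_integral_cong_AE; eventually_elim; simp add: recip_real_two_point[OF neg])+
    then show ?thesis
      using False U.emeasure_space_1 by (simp add: two_point_weight(3)[OF neg])
  qed
  finally show ?thesis .
qed

lemma ext_integral_two_point:
  assumes ab: "a * b \<le> 0" and f [measurable]: "f \<in> borel_measurable (borel \<Otimes>\<^sub>M borel)"
  shows "quasi_integrable (two_point_space a b) (two_point_fun f a b)"
    and "ext_integral (two_point_space a b) (two_point_fun f a b) = ereal (two_point_mean f a b)"
proof -
  interpret integrable_law "two_point a b" by (rule integrable_law_two_point)
  have meas: "two_point_fun f a b \<in> borel_measurable (two_point_space a b)"
    unfolding two_point_fun_def two_point_space_def by measurable
  have "- two_point_fun f a b z = two_point_fun (\<lambda>z. - f z) a b z" for z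
    by (simp add: two_point_fun_def case_prod_beta)
  then have neg: "(\<integral>\<^sup>+z. e2ennreal (- two_point_fun f a b z) \<partial>two_point_space a b) =
    (if a * b = 0 then ennreal (- f (0, 0))
     else ennreal (b / (b - a)) * ennreal (- f (a, b)) + ennreal (a / (a - b)) * ennreal (- f (b, a)))"
    using nn_integral_two_point_fun[OF ab, of "\<lambda>z. - f z"] by simp
  note pos = nn_integral_two_point_fun[OF ab f]
  show "quasi_integrable (two_point_space a b) (two_point_fun f a b)"
    using meas unfolding quasi_integrable_def pos
    by (auto simp: ennreal_mult_less_top)
  show "ext_integral (two_point_space a b) (two_point_fun f a b) = ereal (two_point_mean f a b)"
  proof (cases "a * b = 0")
    case True
    have "enn2ereal (ennreal r) - enn2ereal (ennreal (- r)) = ereal r" for r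
      by (cases "0 \<le> r") (simp_all add: ennreal_neg zero_ennreal.rep_eq)
    with True show ?thesis
      unfolding ext_integral_def pos neg two_point_mean_def by (simp only: refl if_True)
  next
    case False
    with ab have less: "a * b < 0" by (rule le_neq_trans)
    define p q where "p = b / (b - a)" and "q = a / (a - b)"
    have w: "0 \<le> p" "0 \<le> q" using two_point_weight[OF less] by (auto simp: p_def q_def)
    have e: "enn2ereal (ennreal p * ennreal x + ennreal q * ennreal y) = ereal (p * max 0 x + q * max 0 y)" for x y
    proof -
      have nonneg: "0 \<le> p * max 0 x" "0 \<le> q * max 0 y" using w by simp_all
      then have "ennreal (p * max 0 x + q * max 0 y) = ennreal p * ennreal x + ennreal q * ennreal y"
        using w by (simp add: ennreal_mult)
      then show ?thesis
        using nonneg by (metis add_nonneg_nonneg enn2ereal_ennreal)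
    qed
    \<comment> \<open>Positive part minus negative part gives back the number itself, in each
      argument.\<close>
    have "p * max 0 x + q * max 0 y - (p * max 0 (- x) + q * max 0 (- y)) = p * x + q * y" for x y
      by (simp add: max_def algebra_simps)
    then show ?thesis
      using False unfolding ext_integral_def pos neg p_def[symmetric] q_def[symmetric] if_not_P[OF False] e
      by (simp add: two_point_mean_def p_def q_def)
  qed
qed

section \<open>Transfer to the given random variables\<close>

theorem theorem2p2:
  fixes M :: "'a measure" and X U :: "'a \<Rightarrow> real" and g :: "real \<times> real \<Rightarrow> real"
  assumes "prob_space M"
    and "integrable M X"
    and "integral\<^sup>L M X = 0"
    and "prob_space.indep_var M borel X borel U"
    and "distr M borel U = uniform01"
    and "g \<in> borel_measurable borel"
    and "(bdd_below (range g) \<or> bdd_above (range g)) \<or>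
         (\<exists>c::real. bdd_below (range (\<lambda>(x, r). g (x, r) - c * x)) \<or>
                    bdd_above (range (\<lambda>(x, r). g (x, r) - c * x)))"
  defines "\<nu> \<equiv> distr M borel X"
  defines "lhs_fun \<equiv> (\<lambda>\<omega>. ereal (g (X \<omega>, recip_real \<nu> (X \<omega>) (U \<omega>))))"
  defines "rhs_fun \<equiv> (\<lambda>(x, u). ext_integral (two_point_space x (recip_real \<nu> x u))
                                            (two_point_fun g x (recip_real \<nu> x u)))"
  shows "quasi_integrable M lhs_fun \<and>
         (AE (x, u) in \<nu> \<Otimes>\<^sub>M uniform01.
            quasi_integrable (two_point_space x (recip_real \<nu> x u))
                             (two_point_fun g x (recip_real \<nu> x u))) \<and>
         quasi_integrable (\<nu> \<Otimes>\<^sub>M uniform01) rhs_fun \<and>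
         ext_integral M lhs_fun = ext_integral (\<nu> \<Otimes>\<^sub>M uniform01) rhs_fun"
proof -
  interpret M: prob_space M by fact
  have X [measurable]: "X \<in> borel_measurable M" and U [measurable]: "U \<in> borel_measurable M"
    using M.indep_var_rv1[OF assms(4)] M.indep_var_rv2[OF assms(4)] by simp_all
  have joint: "distr M (borel \<Otimes>\<^sub>M borel) (\<lambda>\<omega>. (X \<omega>, U \<omega>)) = \<nu> \<Otimes>\<^sub>M uniform01"
    using assms(4,5) by (simp add: M.indep_var_distribution_eq \<nu>_def)
  have g: "g \<in> borel_measurable (borel \<Otimes>\<^sub>M borel)"
    using assms(6) by (simp add: borel_prod)
  interpret \<nu>: integrable_law \<nu>
    using M.real_distribution_distr[OF X] assms(2) X
    by (simp add: \<nu>_def integrable_law_def integrable_law_axioms_def integrable_distr_eq)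
  have mean: "integral\<^sup>L \<nu> (\<lambda>x. x) = 0"
    using assms(3) X by (simp add: \<nu>_def integral_distr)
  let ?P = "\<nu> \<Otimes>\<^sub>M uniform01"
  let ?f = "\<lambda>g z. ereal (g (fst z, recip_real \<nu> (fst z) (snd z)))"
  let ?H = "\<lambda>g z. ereal (two_point_mean g (fst z) (recip_real \<nu> (fst z) (snd z)))"
  \<comment> \<open>An identity at every point, thanks to the sign condition holding
    everywhere.\<close>
  have rhs: "rhs_fun = ?H g"
    using ext_integral_two_point(2)[OF \<nu>.mult_recip_real_nonpos g]
    by (auto simp: rhs_fun_def fun_eq_iff)
  \<comment> \<open>Plain boundedness is the case \<open>c = 0\<close>.\<close>
  obtain c d where "(\<forall>x y. d \<le> g (x, y) - c * x) \<or> (\<forall>x y. g (x, y) - c * x \<le> d)"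
  proof -
    have "\<exists>c. bdd_below (range (\<lambda>(x, r). g (x, r) - c * x)) \<or> bdd_above (range (\<lambda>(x, r). g (x, r) - c * x))"
      using assms(7)
    proof
      assume "bdd_below (range g) \<or> bdd_above (range g)"
      then show ?thesis by (intro exI[of _ 0]) (simp add: case_prod_beta)
    qed
    then show thesis
      using that by (auto simp: bdd_below_def bdd_above_def)
  qed
  then have main: "quasi_integrable ?P (?f g) \<and> quasi_integrable ?P (?H g) \<and>
    ext_integral ?P (?f g) = ext_integral ?P (?H g)"
  proof
    assume "\<forall>x y. d \<le> g (x, y) - c * x"
    then show ?thesis by (intro \<nu>.ext_integral_recip_real[OF mean g]) auto
  next
    assume upper: "\<forall>x y. g (x, y) - c * x \<le> d"
    \<comment> \<open>An upper bound for \<open>g\<close> is a lower bound for \<open>- g\<close>,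
      with \<open>- c\<close> and \<open>- d\<close>.\<close>
    have "quasi_integrable ?P (?f (\<lambda>z. - g z)) \<and> quasi_integrable ?P (?H (\<lambda>z. - g z)) \<and>
      ext_integral ?P (?f (\<lambda>z. - g z)) = ext_integral ?P (?H (\<lambda>z. - g z))"
    proof (rule \<nu>.ext_integral_recip_real[OF mean])
      show "- d \<le> - g (x, y) - (- c) * x" for x y
        using upper[rule_format, of x y] by simp
    qed (use g in simp)
    then show ?thesis
      using quasi_integrable_uminus[of ?P "?f (\<lambda>z. - g z)"] quasi_integrable_uminus[of ?P "?H (\<lambda>z. - g z)"]
      by (simp add: two_point_mean_uminus)
  qed
  \<comment> \<open>Independence makes the joint law of \<open>X\<close> and \<open>U\<close> the
    product measure, so the left side is an image integral.\<close>
  have lhs: "quasi_integrable M lhs_fun" "ext_integral M lhs_fun = ext_integral ?P (?f g)"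
    using quasi_integrable_distr[of "\<lambda>\<omega>. (X \<omega>, U \<omega>)" M "borel \<Otimes>\<^sub>M borel" "?f g"] main
    by (simp_all add: joint lhs_fun_def)
  show ?thesis
    using lhs main ext_integral_two_point(1)[OF \<nu>.mult_recip_real_nonpos g]
    by (simp add: rhs)
qed

end
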